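(* Let $\varphi:\mathbb{D}\to\mathbb{D}$ be holomorphic and $h\in\mathcal{H}^2$. For $\delta>0$ put $A_\delta=\{z\in\mathbb{T}:|\varphi(z)|\ge 1-\delta\}$. (1) If for some $\delta>0$ there is a constant $c_\delta>0$ such that $|h(z)|\le c_\delta$ for almost every $z\in A_\delta$, then the weighted composition operator $W_{h,\varphi}$ is bounded on $\mathcal{H}^2$. (2) If, in addition, such constants $c_\delta$ (with $|h|\le c_\delta$ a.e. on $A_\delta$) exist for all sufficiently small $\delta>0$ and can be chosen so that $c_\delta\to 0$ as $\delta\to 0$, then $W_{h,\varphi}$ is a compact operator on $\mathcal{H}^2$.
   Context: $\mathbb{D}$ is the open unit disc in $\mathbb{C}$ and $\mathbb{T}$ the unit circle with normalized Lebesgue measure. $\mathcal{H}^2$ is the Hardy space of holomorphic $f$ on $\mathbb{D}$ with $\|f\|_2^2=\sup_{0\le r<1}\int_0^{2\pi}|f(re^{i\theta})|^2\,\frac{d\theta}{2\pi}<\infty$. Values of $h$ and $\varphi$ on $\mathbb{T}$ are radial limits, which exist almost everywhere. The weighted composition operator is $W_{h,\varphi}f(z)=h(z)f(\varphi(z))$. *)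

theory Defs
  imports "HOL-Complex_Analysis.Complex_Analysis"
begin

abbreviation unit_disc :: "complex set" where
  "unit_disc \<equiv> ball 0 1"

definition circle_measure :: "complex measure" where
  "circle_measure = distr (uniform_measure lborel {0..2 * pi}) borel cis"

definition circle_mean_square :: "(complex \<Rightarrow> complex) \<Rightarrow> real \<Rightarrow> real" where
  "circle_mean_square f r =
     (LBINT \<theta>:{0..2 * pi}. (cmod (f (of_real r * cis \<theta>)))\<^sup>2) / (2 * pi)"

text \<open>
  Functions on the disc are represented by total functions on the complex plane whose values
  outside the disc are irrelevant. Two elements of \<open>hardy2\<close> are therefore the same function
  when they agree on the disc, equivalently when \<open>hardy2_norm\<close> of their difference is zero.
\<close>

definition hardy2 :: "(complex \<Rightarrow> complex) set" where
  "hardy2 = {f. f holomorphic_on unit_disc \<and> bdd_above (circle_mean_square f ` {0..<1})}"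

definition hardy2_norm :: "(complex \<Rightarrow> complex) \<Rightarrow> real" where
  "hardy2_norm f = sqrt (SUP r\<in>{0..<1}. circle_mean_square f r)"

text \<open>
  \<open>Lim\<close> is unspecified where the radial limit does not exist; for functions in \<open>hardy2\<close> and for
  bounded holomorphic functions this concerns only a null set of the circle.
\<close>

definition radial_limit :: "(complex \<Rightarrow> complex) \<Rightarrow> complex \<Rightarrow> complex" where
  "radial_limit f z = Lim (at_left 1) (\<lambda>r::real. f (of_real r * z))"

definition near_boundary_set :: "(complex \<Rightarrow> complex) \<Rightarrow> real \<Rightarrow> complex set" where
  "near_boundary_set \<phi> \<delta> = {z \<in> sphere 0 1. cmod (radial_limit \<phi> z) \<ge> 1 - \<delta>}"

definition weighted_comp ::
    "(complex \<Rightarrow> complex) \<Rightarrow> (complex \<Rightarrow> complex) \<Rightarrow> (complex \<Rightarrow> complex) \<Rightarrow> complex \<Rightarrow> complex" where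
  "weighted_comp h \<phi> f = (\<lambda>z. h z * f (\<phi> z))"

definition linear_on_hardy2 :: "((complex \<Rightarrow> complex) \<Rightarrow> complex \<Rightarrow> complex) \<Rightarrow> bool" where
  "linear_on_hardy2 T \<longleftrightarrow>
     (\<forall>f\<in>hardy2. T f \<in> hardy2) \<and>
     (\<forall>f\<in>hardy2. \<forall>g\<in>hardy2. \<forall>a b. \<forall>z\<in>unit_disc.
        T (\<lambda>w. a * f w + b * g w) z = a * T f z + b * T g z)"

definition bounded_on_hardy2 :: "((complex \<Rightarrow> complex) \<Rightarrow> complex \<Rightarrow> complex) \<Rightarrow> bool" where
  "bounded_on_hardy2 T \<longleftrightarrow>
     linear_on_hardy2 T \<and> (\<exists>C. \<forall>f\<in>hardy2. hardy2_norm (T f) \<le> C * hardy2_norm f)"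

text \<open>
  An operator is compact if the image of every norm-bounded sequence has a subsequence
  that converges in norm to an element of the space.
\<close>

definition compact_on_hardy2 :: "((complex \<Rightarrow> complex) \<Rightarrow> complex \<Rightarrow> complex) \<Rightarrow> bool" where
  "compact_on_hardy2 T \<longleftrightarrow>
     linear_on_hardy2 T \<and>
     (\<forall>F :: nat \<Rightarrow> complex \<Rightarrow> complex.
        (\<forall>n. F n \<in> hardy2) \<and> (\<exists>B. \<forall>n. hardy2_norm (F n) \<le> B) \<longrightarrow>
        (\<exists>s g. strict_mono s \<and> g \<in> hardy2 \<and>
           (\<lambda>n. hardy2_norm (\<lambda>z. T (F (s n)) z - g z)) \<longlonglongrightarrow> 0))"

end

theory Submission
  imports Defs
begin

text \<open>
  On the part of the circle where \<open>\<bar>\<phi>\<bar> \<ge> 1 - \<delta>\<close> the weight is at most \<open>c\<close>, and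
  Littlewood's subordination principle bounds the contribution of \<open>f \<circ> \<phi>\<close>; on the rest
  \<open>f \<circ> \<phi>\<close> is bounded by the supremum \<open>m\<close> of \<open>\<bar>f\<bar>\<close> on the disc of radius \<open>1 - \<delta>\<close>.
  This gives \<open>\<parallel>W f\<parallel>\<^sup>2 \<le> c\<^sup>2 K \<parallel>f\<parallel>\<^sup>2 + m\<^sup>2 \<parallel>h\<parallel>\<^sup>2\<close>. Boundedness follows because point evaluations
  are bounded by the norm. For compactness, a bounded sequence has by Montel's theorem a locally
  uniformly convergent subsequence, so \<open>m \<rightarrow> 0\<close> along the differences for fixed \<open>\<delta>\<close>, and
  then \<open>c \<rightarrow> 0\<close> as \<open>\<delta> \<rightarrow> 0\<close>.

  When \<open>f\<close> is a Taylor polynomial the boundary values of \<open>h \<sqdot> f \<circ> \<phi>\<close> are products of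
  boundary values, and the general case follows by approximation. Fatou's theorem on radial limits comes from
  a weak-type maximal inequality (Poisson formula and Vitali's covering lemma) and the density of
  polynomials.
\<close>

section \<open>The Poisson kernel\<close>

text \<open>The obstacle is the composition rule on the circle: where \<phi> reaches the boundary, a
  general f has only radial limits almost everywhere, and the path traced by \<phi> is not radial. A
  polynomial is continuous on the closed disc, so for it the rule is immediate; moreover its
  composition with \<phi> is bounded, which keeps the product with h in \<open>hardy2\<close>. The
  passage to f uses only pointwise convergence and Fatou's lemma on a circle of fixed radius, so it
  presupposes nothing about the operator on f.

  The weight is controlled on the boundary while the norm is defined inside the disc. Hence boundary
  integrals and mean squares must be compared in both directions: Fatou's lemma gives one, and the
  vanishing of Taylor tails gives the other. Squared moduli are bounded by Poisson integrals by
  applying the Poisson formula to the square of a holomorphic function, so no convexity argument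
  enters.\<close>

definition poisson_kernel :: "real \<Rightarrow> real \<Rightarrow> real" where
  "poisson_kernel r t = (1 - r\<^sup>2) / (1 - 2 * r * cos t + r\<^sup>2)"

lemma norm_one_minus_cis_squared:
  "(cmod (1 - of_real r * cis t))\<^sup>2 = 1 - 2 * r * cos t + r\<^sup>2"
proof -
  have "(cmod (1 - of_real r * cis t))\<^sup>2 = (1 - r * cos t)\<^sup>2 + (r * sin t)\<^sup>2"
    by (simp add: cmod_power2)
  also have "\<dots> = 1 - 2 * r * cos t + r\<^sup>2 * ((sin t)\<^sup>2 + (cos t)\<^sup>2)"
    by algebra
  finally show ?thesis by simp
qed

lemma poisson_denominator_pos:
  assumes "\<bar>r::real\<bar> < 1"
  shows "0 < 1 - 2 * r * cos t + r\<^sup>2"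
proof -
  have "cmod (of_real r * cis t) < 1"
    using assms by (simp add: norm_mult)
  then have "1 - of_real r * cis t \<noteq> 0"
    by (metis norm_one order_less_irrefl right_minus_eq)
  then have "0 < (cmod (1 - of_real r * cis t))\<^sup>2" by simp
  then show ?thesis by (simp only: norm_one_minus_cis_squared)
qed

lemma poisson_kernel_nonneg:
  assumes "\<bar>r::real\<bar> < 1"
  shows "0 \<le> poisson_kernel r t"
  unfolding poisson_kernel_def using poisson_denominator_pos[OF assms, of t] assms
  by (auto intro!: divide_nonneg_pos simp: abs_square_le_1)

lemma continuous_on_poisson_kernel [continuous_intros]:
  assumes "\<bar>r::real\<bar> < 1"
  shows "continuous_on S (poisson_kernel r)"
  unfolding poisson_kernel_def
  by (intro continuous_intros) (use poisson_denominator_pos[OF assms] in \<open>metis order_less_irrefl\<close>)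

text \<open>This is Cauchy's formula at z for \<open>F\<close>, which multiplies f by a factor that
  equals 1 at z and has no pole in the closed disc. On the circle the conjugate of
  \<open>1 - cnj z * u\<close> is \<open>(u - z) / u\<close>, so the factor and the Cauchy kernel
  combine into the Poisson kernel.\<close>

lemma poisson_formula:
  fixes f :: "complex \<Rightarrow> complex"
  assumes f: "f holomorphic_on cball 0 1" and z: "z \<in> unit_disc"
  shows "((\<lambda>t. f (cis t) * of_real ((1 - (cmod z)\<^sup>2) / (cmod (1 - cnj z * cis t))\<^sup>2))
           has_integral 2 * pi * f z) {0..2 * pi}"
proof -
  define F where "F = (\<lambda>u. f u * of_real (1 - (cmod z)\<^sup>2) / (1 - cnj z * u))"
  have ne: "1 - cnj z * u \<noteq> 0" if "cmod u \<le> 1" for u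
  proof
    assume "1 - cnj z * u = 0"
    then have "cmod (cnj z * u) = 1" by (metis eq_iff_diff_eq_0 norm_one)
    moreover have "cmod (cnj z * u) \<le> cmod z * 1"
      using that by (simp add: norm_mult mult_left_le)
    ultimately show False using z by simp
  qed
  have "F holomorphic_on cball 0 1"
    unfolding F_def using ne by (intro holomorphic_on_divide holomorphic_on_mult f holomorphic_intros) auto
  then have "((\<lambda>u. F u / (u - z)) has_contour_integral 2 * of_real pi * \<i> * F z) (circlepath 0 1)"
    using z by (intro Cauchy_integral_circlepath_simple) auto
  then have "((\<lambda>t. F (cis t) / (cis t - z) * \<i> * cis t) has_integral 2 * of_real pi * \<i> * F z) {0..2 * pi}"
    unfolding circlepath_def by (subst (asm) has_contour_integral_part_circlepath_iff) auto
  from has_integral_mult_right[OF this, of "- \<i>"]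
  have "((\<lambda>t. - \<i> * (F (cis t) / (cis t - z) * \<i> * cis t)) has_integral 2 * of_real pi * F z) {0..2 * pi}"
    by (rule has_integral_eq_rhs) (simp add: ac_simps)
  moreover have "- \<i> * (F (cis t) / (cis t - z) * \<i> * cis t)
      = f (cis t) * of_real ((1 - (cmod z)\<^sup>2) / (cmod (1 - cnj z * cis t))\<^sup>2)" for t
  proof -
    have nz: "cis t - z \<noteq> 0" using z by auto
    have "of_real ((cmod (1 - cnj z * cis t))\<^sup>2) = (1 - cnj z * cis t) * cnj (1 - cnj z * cis t)"
      by (metis complex_norm_square)
    also have "cnj (1 - cnj z * cis t) = (cis t - z) / cis t"
      by (simp add: field_simps cis_cnj cis_mult)
    finally have eq: "of_real ((cmod (1 - cnj z * cis t))\<^sup>2) = (1 - cnj z * cis t) * ((cis t - z) / cis t)" .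
    show ?thesis
      unfolding of_real_divide eq F_def using ne[of "cis t"] nz by (simp add: field_simps)
  qed
  moreover have "F z = f z"
  proof -
    have "1 - cnj z * z = of_real (1 - (cmod z)\<^sup>2)"
      by (simp add: mult.commute flip: complex_norm_square)
    then show ?thesis unfolding F_def using ne[of z] z by simp
  qed
  ultimately show ?thesis by simp
qed

text \<open>Rotating the evaluation point puts the peak of the kernel at t = 0, in the middle of the
  interval, as the comparison with centred averages requires.\<close>

lemma poisson_formula_radial:
  fixes f :: "complex \<Rightarrow> complex"
  assumes f: "f holomorphic_on cball 0 1" and r: "0 \<le> r" "r < 1"
  shows "((\<lambda>t. f (cis (\<theta> + t)) * of_real (poisson_kernel r t))
           has_integral 2 * pi * f (of_real r * cis \<theta>)) {-pi..pi}"
proof -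
  \<comment> \<open>The minus sign moves the evaluation point to -r; the later shift by pi undoes it
    and turns the interval from 0 to 2 pi into the one centred at 0.\<close>
  define g where "g = (\<lambda>z. f (- (z * cis \<theta>)))"
  have "g holomorphic_on cball 0 1"
    unfolding g_def
    by (rule holomorphic_on_compose_gen[OF _ f, unfolded o_def])
       (auto intro!: holomorphic_intros simp: norm_mult)
  from poisson_formula[OF this, of "- of_real r"] r
  have "((\<lambda>t. g (cis t) * of_real ((1 - r\<^sup>2) / (cmod (1 - of_real (- r) * cis t))\<^sup>2))
           has_integral 2 * pi * f (of_real r * cis \<theta>)) (cbox 0 (2 * pi))"
    by (simp add: g_def)
  then have "((\<lambda>t. g (cis t) * of_real ((1 - r\<^sup>2) / (1 + 2 * r * cos t + r\<^sup>2)))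
           has_integral 2 * pi * f (of_real r * cis \<theta>)) (cbox 0 (2 * pi))"
    unfolding norm_one_minus_cis_squared by simp
  from has_integral_affinity'[OF this, of 1 pi]
  show ?thesis
    by (simp add: g_def poisson_kernel_def cis_mult[symmetric] mult.commute)
qed

lemma integral_poisson_kernel:
  assumes r: "0 \<le> r" "r < 1"
  shows "integral {-pi..pi} (poisson_kernel r) = 2 * pi"
proof -
  have "((\<lambda>t. complex_of_real (poisson_kernel r t)) has_integral 2 * pi) {-pi..pi}"
    using poisson_formula_radial[of "\<lambda>_. 1" r 0] r by simp
  from has_integral_Re[OF this] show ?thesis by (simp add: integral_unique)
qed

lemma has_derivative_poisson_kernel:
  assumes "\<bar>r::real\<bar> < 1"
  shows "(poisson_kernel r has_real_derivative
           - ((1 - r\<^sup>2) * (2 * r * sin t)) / (1 - 2 * r * cos t + r\<^sup>2)\<^sup>2) (at t)"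
  unfolding poisson_kernel_def using poisson_denominator_pos[OF assms, of t]
  by (auto intro!: derivative_eq_intros simp: power2_eq_square)

lemma integral_symmetric_split:
  fixes u :: "real \<Rightarrow> real"
  assumes u: "continuous_on UNIV u" and s: "0 \<le> s"
  shows "integral {-s..s} u = integral {0..s} (\<lambda>t. u t + u (- t))"
proof -
  have int: "u integrable_on {a..b}" for a b
    by (intro integrable_continuous_interval continuous_on_subset[OF u]) auto
  have "integral {-s..0} u = integral {0..s} (\<lambda>t. u (- t))"
    using Henstock_Kurzweil_Integration.integral_reflect_real[of s 0 "\<lambda>t. u (- t)"] by simp
  moreover have "(\<lambda>t. u (- t)) integrable_on {0..s}"
    by (intro integrable_continuous_interval continuous_on_compose2[OF u] continuous_intros) auto
  moreover have "integral {-s..0} u + integral {0..s} u = integral {-s..s} u"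
    by (rule Henstock_Kurzweil_Integration.integral_combine) (use s int in auto)
  ultimately show ?thesis
    by (simp add: Henstock_Kurzweil_Integration.integral_add int)
qed

text \<open>Integration by parts in disguise: since the kernel decreases on \<open>[0, \<pi>]\<close>, it is a
  superposition of normalized indicators of centred intervals.\<close>

lemma poisson_integral_le_averages:
  fixes u :: "real \<Rightarrow> real"
  assumes u: "continuous_on UNIV u" and r: "0 \<le> r" "r < 1"
    and avg: "\<And>s. 0 < s \<Longrightarrow> s \<le> pi \<Longrightarrow> integral {-s..s} u \<le> \<beta> * s"
  shows "integral {-pi..pi} (\<lambda>t. u t * poisson_kernel r t) \<le> \<beta> * pi"
proof -
  define k where "k = poisson_kernel r"
  define k' where "k' t = - ((1 - r\<^sup>2) * (2 * r * sin t)) / (1 - 2 * r * cos t + r\<^sup>2)\<^sup>2" for t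
  define v where "v t = u t + u (- t)" for t
  have k': "(k has_real_derivative k' t) (at t)" for t
    unfolding k_def k'_def using r by (intro has_derivative_poisson_kernel) auto
  have contk: "continuous_on S k" for S
    unfolding k_def using r by (intro continuous_intros) auto
  have contv: "continuous_on S v" for S
    unfolding v_def by (intro continuous_intros continuous_on_compose2[OF u]) auto
  define V where "V s = integral {0..s} v" for s
  define A where "A s = integral {0..s} (\<lambda>t. v t * k t)" for s
  define K where "K s = integral {0..s} k" for s
  \<comment> \<open>By parts, \<open>K s - s * k s\<close> is the integral of -s k' and
    \<open>A s - V s * k s\<close> that of -V k'. So \<open>D\<close> has derivative
    \<open>(V s - \<beta> * s) * k' s\<close>, a product of two nonpositive factors, and its
    monotonicity is the whole estimate.\<close>
  define D where "D s = \<beta> * (K s - s * k s) - (A s - V s * k s)" for s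
  have deriv: "((\<lambda>s. integral {0..s} w) has_real_derivative w s) (at s)"
    if "continuous_on {0..pi} w" "0 < s" "s < pi" for w :: "real \<Rightarrow> real" and s
    using integral_has_real_derivative[OF that(1), of s] that at_within_interior[of s "{0..pi}"]
    by auto
  have "D 0 \<le> D pi"
  proof (rule DERIV_nonneg_imp_increasing_open[where f = D and a = 0 and b = pi])
    fix s :: real assume s: "0 < s" "s < pi"
    have "(D has_real_derivative (V s - \<beta> * s) * k' s) (at s)"
      unfolding D_def V_def A_def K_def
      by (rule derivative_eq_intros deriv s k' contk contv continuous_intros refl)+
         (simp add: algebra_simps)
    moreover have "V s \<le> \<beta> * s"
      using avg[of s] s by (simp add: V_def v_def[abs_def] integral_symmetric_split[OF u])
    moreover have "k' s \<le> 0"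
      unfolding k'_def using s r sin_gt_zero[of s] abs_square_le_1[of r]
      by (auto intro!: divide_nonneg_nonneg)
    ultimately show "\<exists>y. (D has_real_derivative y) (at s) \<and> 0 \<le> y"
      by (metis diff_le_0_iff_le mult_nonpos_nonpos)
  next
    have cint: "continuous_on {0..pi} (\<lambda>s. integral {0..s} w)" if "continuous_on {0..pi} w" for w :: "real \<Rightarrow> real"
      by (intro indefinite_integral_continuous_1 integrable_continuous_interval that)
    show "continuous_on {0..pi} D"
      unfolding D_def V_def A_def K_def by (intro continuous_intros cint contk contv)
  qed simp
  moreover have "D 0 = 0" by (simp add: D_def K_def A_def V_def)
  ultimately have "A pi \<le> \<beta> * K pi + (V pi - \<beta> * pi) * k pi"
    by (simp add: D_def algebra_simps)
  moreover have "V pi - \<beta> * pi \<le> 0"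
    using avg[of pi] by (simp add: V_def v_def[abs_def] integral_symmetric_split[OF u])
  moreover have "0 \<le> k pi" unfolding k_def using r by (intro poisson_kernel_nonneg) auto
  ultimately have "A pi \<le> \<beta> * K pi" by (smt (verit) mult_nonpos_nonneg)
  moreover have even: "k (- t) = k t" for t by (simp add: k_def poisson_kernel_def)
  have "K pi = pi"
    using integral_symmetric_split[OF contk, of pi] integral_poisson_kernel[OF r]
    by (simp add: K_def even k_def[symmetric])
  moreover have "integral {-pi..pi} (\<lambda>t. u t * k t) = A pi"
    using integral_symmetric_split[of "\<lambda>t. u t * k t" pi] u contk
    by (simp add: A_def v_def even continuous_on_mult algebra_simps)
  ultimately show ?thesis by (simp add: k_def)
qed

section \<open>The radial maximal function\<close>

text \<open>Countable subadditivity with the sum written as an integral over counting measure, since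
  the centres supplied by Vitali's lemma form a countable set without an enumeration.\<close>

lemma emeasure_UN_le_nn_integral_count_space:
  assumes C: "countable C" and X: "\<And>i. i \<in> C \<Longrightarrow> X i \<in> sets M"
  shows "emeasure M (\<Union>i\<in>C. X i) \<le> (\<integral>\<^sup>+i. emeasure M (X i) \<partial>count_space C)"
proof -
  have "(\<Union>i\<in>C. X i) \<in> sets M" using C X by auto
  then have "emeasure M (\<Union>i\<in>C. X i) = (\<integral>\<^sup>+x. indicator (\<Union>i\<in>C. X i) x \<partial>M)" by simp
  also have "\<dots> \<le> (\<integral>\<^sup>+x. \<integral>\<^sup>+i. indicator (X i) x \<partial>count_space C \<partial>M)"
  proof (rule nn_integral_mono)
    fix x
    show "indicator (\<Union>i\<in>C. X i) x \<le> (\<integral>\<^sup>+i. indicator (X i) x \<partial>count_space C :: ennreal)"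
    proof (cases "x \<in> (\<Union>i\<in>C. X i)")
      case True
      then obtain j where "j \<in> C" "x \<in> X j" by blast
      then show ?thesis
        using nn_integral_ge_point[of j C "\<lambda>i. indicator (X i) x :: ennreal"] True by simp
    qed simp
  qed
  also have "\<dots> = (\<integral>\<^sup>+i. \<integral>\<^sup>+x. indicator (X i) x \<partial>M \<partial>count_space C)"
    using X by (intro nn_integral_count_space_nn_integral C) auto
  also have "\<dots> = (\<integral>\<^sup>+i. emeasure M (X i) \<partial>count_space C)"
    using X by (intro nn_integral_cong) auto
  finally show ?thesis .
qed

lemma nn_integral_Icc_continuous:
  fixes u :: "real \<Rightarrow> real"
  assumes u: "continuous_on {a..b} u" and pos: "\<And>t. t \<in> {a..b} \<Longrightarrow> 0 \<le> u t"
  shows "(\<integral>\<^sup>+t. ennreal (u t) * indicator {a..b} t \<partial>lborel) = ennreal (integral {a..b} u)"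
  using nn_integral_has_integral_lebesgue'[OF pos integrable_integral[OF integrable_continuous_interval[OF u]]]
  by simp

text \<open>The Hardy-Littlewood argument: Vitali's lemma selects disjoint intervals whose fivefold
  enlargements cover E. An enlargement has length \<open>10 * \<sigma> i\<close>, less than
  10/\<beta> times the mass of u on the selected interval, and by disjointness these masses add up
  to at most the mass on the enlarged interval. The bound S makes the covering lemma applicable and
  confines the selected intervals.\<close>

lemma weak_type_from_averages:
  fixes u :: "real \<Rightarrow> real"
  assumes u: "continuous_on UNIV u" and pos: "\<And>t. 0 \<le> u t" and "0 < \<beta>" and "0 \<le> S"
    and avg: "\<And>\<theta>. \<theta> \<in> E \<Longrightarrow> \<exists>s. 0 < s \<and> s \<le> S \<and> \<beta> * s < integral {\<theta> - s..\<theta> + s} u"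
    and E: "E \<subseteq> {a..b}"
  shows "emeasure lborel E \<le> ennreal (10 / \<beta> * integral {a - S..b + S} u)"
proof -
  have [measurable]: "u \<in> borel_measurable borel"
    using u by (rule borel_measurable_continuous_onI)
  obtain \<sigma> where \<sigma>: "0 < \<sigma> \<theta> \<and> \<sigma> \<theta> \<le> S" "\<beta> * \<sigma> \<theta> < integral {\<theta> - \<sigma> \<theta>..\<theta> + \<sigma> \<theta>} u"
    if "\<theta> \<in> E" for \<theta>
    using avg by metis
  have "E \<subseteq> (\<Union>\<theta>\<in>E. cball \<theta> (\<sigma> \<theta>))" using \<sigma>(1) by force
  from Vitali_covering_lemma_cballs[where S = E and a = id and K = E and r = \<sigma>, OF _ \<sigma>(1)] this
  obtain C where C: "countable C" "C \<subseteq> E"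
     "pairwise (\<lambda>i j. disjnt (cball i (\<sigma> i)) (cball j (\<sigma> j))) C"
     "E \<subseteq> (\<Union>i\<in>C. cball i (5 * \<sigma> i))"
    by (auto simp: id_def)
  \<comment> \<open>Reading integrals of u as a measure turns the summation over disjoint intervals
    into countable additivity.\<close>
  define \<mu> where "\<mu> = density lborel (\<lambda>t. ennreal (u t))"
  have \<mu>: "emeasure \<mu> {x..y} = ennreal (integral {x..y} u)" for x y
    unfolding \<mu>_def using nn_integral_Icc_continuous[OF continuous_on_subset[OF u], of x y] pos
    by (simp add: emeasure_density)
  have "emeasure lborel E \<le> emeasure lborel (\<Union>i\<in>C. cball i (5 * \<sigma> i))"
    using C by (intro emeasure_mono) auto
  also have "\<dots> \<le> (\<integral>\<^sup>+i. emeasure lborel (cball i (5 * \<sigma> i)) \<partial>count_space C)"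
    by (intro emeasure_UN_le_nn_integral_count_space C) auto
  also have "\<dots> \<le> (\<integral>\<^sup>+i. ennreal (10 / \<beta>) * emeasure \<mu> (cball i (\<sigma> i)) \<partial>count_space C)"
  proof (rule nn_integral_mono)
    fix i assume "i \<in> space (count_space C)"
    then have i: "i \<in> E" using C by auto
    have "emeasure lborel (cball i (5 * \<sigma> i)) = ennreal (10 * \<sigma> i)"
      using \<sigma>(1)[OF i] by (simp add: cball_eq_atLeastAtMost)
    also have "\<dots> \<le> ennreal (10 / \<beta> * integral {i - \<sigma> i..i + \<sigma> i} u)"
      using \<sigma>(2)[OF i] \<open>0 < \<beta>\<close> by (intro ennreal_leI) (simp add: field_simps)
    also have "\<dots> = ennreal (10 / \<beta>) * emeasure \<mu> (cball i (\<sigma> i))"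
      using \<open>0 < \<beta>\<close> by (subst ennreal_mult') (simp_all add: cball_eq_atLeastAtMost \<mu>)
    finally show "emeasure lborel (cball i (5 * \<sigma> i)) \<le> \<dots>" .
  qed
  also have "\<dots> = ennreal (10 / \<beta>) * (\<integral>\<^sup>+i. emeasure \<mu> (cball i (\<sigma> i)) \<partial>count_space C)"
    by (rule nn_integral_cmult) simp
  also have "(\<integral>\<^sup>+i. emeasure \<mu> (cball i (\<sigma> i)) \<partial>count_space C) = emeasure \<mu> (\<Union>i\<in>C. cball i (\<sigma> i))"
    using C(1,3) by (intro emeasure_UN_countable[symmetric])
      (auto simp: \<mu>_def disjoint_family_on_def pairwise_def disjnt_def)
  also have "\<dots> \<le> emeasure \<mu> {a - S..b + S}"
  proof (rule emeasure_mono)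
    show "(\<Union>i\<in>C. cball i (\<sigma> i)) \<subseteq> {a - S..b + S}"
    proof (rule UN_least)
      fix i assume "i \<in> C"
      then have "i \<in> E" using C by auto
      then show "cball i (\<sigma> i) \<subseteq> {a - S..b + S}"
        using \<sigma>(1)[of i] E by (auto simp: cball_eq_atLeastAtMost)
    qed
  qed (simp add: \<mu>_def)
  also have "\<dots> = ennreal (integral {a - S..b + S} u)" by (rule \<mu>)
  finally show ?thesis
    using \<open>0 < \<beta>\<close> by (subst ennreal_mult') (simp_all add: mult_left_mono)
qed

lemma integral_periodic_shift:
  fixes u :: "real \<Rightarrow> real"
  assumes per: "\<And>t. u (t + p) = u t"
  shows "integral {a + p..b + p} u = integral {a..b} u"
  using integral_shift_real_ivl[of "a + p" p "b + p" u] by (simp add: per)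

lemma cis_plus_2pi [simp]: "cis (t + 2 * pi) = cis t"
  by (simp add: complex_eq_iff)

text \<open>If every centred average at \<theta> were small, the kernel would transfer this to every
  radial value: integrals at most \<open>2 * \<alpha> * s\<close> bound the Poisson integral by
  \<open>2 * \<alpha> * pi\<close>, hence the squared modulus by \<alpha>. So points of
  \<open>E\<close> have a large average and the covering argument applies with \<beta> = 2 \<alpha>
  and radii up to pi. The intervals stay within three periods, and 10 / (2 \<alpha>) times 3 is the
  constant 15 / \<alpha>.\<close>

lemma radial_maximal_weak_type_dilate:
  fixes q :: "complex \<Rightarrow> complex"
  assumes q: "q holomorphic_on cball 0 1" and "0 < \<alpha>"
    and E: "E \<subseteq> {0..2 * pi}"
    and large: "\<And>\<theta>. \<theta> \<in> E \<Longrightarrow> \<exists>r\<ge>0. r < 1 \<and> \<alpha> < (cmod (q (of_real r * cis \<theta>)))\<^sup>2"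
  shows "emeasure lborel E \<le> ennreal (15 / \<alpha> * integral {0..2 * pi} (\<lambda>t. (cmod (q (cis t)))\<^sup>2))"
proof -
  define u where "u t = (cmod (q (cis t)))\<^sup>2" for t
  have cq: "continuous_on (cball 0 1) q" using q by (rule holomorphic_on_imp_continuous_on)
  have u: "continuous_on UNIV u"
    unfolding u_def by (intro continuous_intros continuous_on_compose2[OF cq]) auto
  have per: "u (t + 2 * pi) = u t" for t by (simp add: u_def)
  have avg: "\<exists>s. 0 < s \<and> s \<le> pi \<and> (2 * \<alpha>) * s < integral {\<theta> - s..\<theta> + s} u" if \<theta>: "\<theta> \<in> E" for \<theta>
  proof (rule ccontr)
    assume contra: "\<not> ?thesis"
    obtain r where r: "0 \<le> r" "r < 1" "\<alpha> < (cmod (q (of_real r * cis \<theta>)))\<^sup>2"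
      using large[OF \<theta>] by auto
    define v where "v t = u (\<theta> + t)" for t
    have v: "continuous_on UNIV v"
      unfolding v_def by (intro continuous_on_compose2[OF u] continuous_intros) auto
    have vint: "integral {- s..s} v = integral {\<theta> - s..\<theta> + s} u" for s
      using integral_shift_real_ivl[of "\<theta> - s" \<theta> "\<theta> + s" u] by (simp add: v_def[abs_def] add.commute)
    \<comment> \<open>Representing the square of \<open>q\<close> makes the plain norm bound for
      integrals yield the squared modulus at once.\<close>
    have "((\<lambda>t. (q (cis (\<theta> + t)))\<^sup>2 * of_real (poisson_kernel r t))
           has_integral 2 * pi * (q (of_real r * cis \<theta>))\<^sup>2) {-pi..pi}"
      using r q by (intro poisson_formula_radial[where f = "\<lambda>z. (q z)\<^sup>2"] holomorphic_intros)
    then have "cmod (2 * pi * (q (of_real r * cis \<theta>))\<^sup>2) \<le> integral {-pi..pi} (\<lambda>t. v t * poisson_kernel r t)"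
    proof (rule has_integral_norm_bound_integral_component[where k = "1 :: real", simplified])
      show "((\<lambda>t. v t * poisson_kernel r t) has_integral integral {-pi..pi} (\<lambda>t. v t * poisson_kernel r t)) {-pi..pi}"
        using r(1,2) by (intro integrable_integral integrable_continuous_interval continuous_intros
          continuous_on_subset[OF v]) auto
    qed (use r(1,2) poisson_kernel_nonneg[of r] in \<open>simp add: v_def u_def norm_mult norm_power\<close>)
    also have "\<dots> \<le> 2 * \<alpha> * pi"
    proof (rule poisson_integral_le_averages[OF v r(1,2)])
      fix s :: real assume "0 < s" "s \<le> pi"
      then show "integral {- s..s} v \<le> 2 * \<alpha> * s"
        using contra unfolding vint by (meson not_le)
    qed
    finally show False using r(3) by (simp add: norm_mult norm_power)
  qed
  have int: "u integrable_on {x..y}" for x y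
    by (intro integrable_continuous_interval continuous_on_subset[OF u]) auto
  have "integral {- pi..3 * pi} u \<le> integral {- (2 * pi)..4 * pi} u"
    by (intro integral_subset_le int) (auto simp: u_def)
  also have "\<dots> = integral {- (2 * pi)..0} u + integral {0..2 * pi} u + integral {2 * pi..4 * pi} u"
  proof -
    have "integral {- (2 * pi)..0} u + integral {0..2 * pi} u = integral {- (2 * pi)..2 * pi} u"
      by (rule Henstock_Kurzweil_Integration.integral_combine) (use int in auto)
    moreover have "integral {- (2 * pi)..2 * pi} u + integral {2 * pi..4 * pi} u = integral {- (2 * pi)..4 * pi} u"
      by (rule Henstock_Kurzweil_Integration.integral_combine) (use int in auto)
    ultimately show ?thesis by simp
  qed
  also have "\<dots> = 3 * integral {0..2 * pi} u"
    using integral_periodic_shift[where u = u and p = "2 * pi", of "- (2 * pi)" 0]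
      integral_periodic_shift[where u = u and p = "2 * pi", of 0 "2 * pi"] per
    by simp
  finally have "10 / (2 * \<alpha>) * integral {- pi..3 * pi} u \<le> 15 / \<alpha> * integral {0..2 * pi} u"
    using \<open>0 < \<alpha>\<close> by (simp add: field_simps)
  moreover have "emeasure lborel E \<le> ennreal (10 / (2 * \<alpha>) * integral {0 - pi..2 * pi + pi} u)"
    using \<open>0 < \<alpha>\<close> by (intro weak_type_from_averages[OF u _ _ _ avg E]) (auto simp: u_def)
  ultimately show ?thesis
    unfolding u_def by (auto intro: order_trans ennreal_leI)
qed

section \<open>Mean squares and Taylor coefficients\<close>

abbreviation angle_measure :: "real measure" where
  "angle_measure \<equiv> restrict_space lborel {0..2 * pi}"

lemma nn_integral_angle_continuous:
  assumes "continuous_on {0..2 * pi} u" and "\<And>t. t \<in> {0..2 * pi} \<Longrightarrow> 0 \<le> u t"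
  shows "(\<integral>\<^sup>+t. ennreal (u t) \<partial>angle_measure) = ennreal (integral {0..2 * pi} u)"
  using nn_integral_Icc_continuous[OF assms] by (simp add: nn_integral_restrict_space)

lemma continuous_on_circle:
  assumes "continuous_on (sphere 0 \<bar>r\<bar>) f"
  shows "continuous_on S (\<lambda>\<theta>. f (of_real r * cis \<theta>))"
  by (intro continuous_on_compose2[OF assms] continuous_intros) (auto simp: norm_mult)

lemma continuous_on_circle_holomorphic:
  assumes "f holomorphic_on unit_disc" "0 \<le> r" "r < 1"
  shows "continuous_on S (\<lambda>\<theta>. f (of_real r * cis \<theta>))"
  using assms by (intro continuous_on_circle continuous_on_subset[OF holomorphic_on_imp_continuous_on[OF assms(1)]])
    auto

lemma circle_mean_square_eq_integral:
  assumes "continuous_on (sphere 0 \<bar>r\<bar>) f"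
  shows "2 * pi * circle_mean_square f r = integral {0..2 * pi} (\<lambda>\<theta>. (cmod (f (of_real r * cis \<theta>)))\<^sup>2)"
proof -
  have "set_integrable lborel {0..2 * pi} (\<lambda>\<theta>. (cmod (f (of_real r * cis \<theta>)))\<^sup>2)"
    by (intro borel_integrable_atLeastAtMost' continuous_intros continuous_on_circle assms)
  from set_borel_integral_eq_integral(2)[OF this] show ?thesis
    by (simp add: circle_mean_square_def)
qed

lemma circle_mean_square_nonneg: "0 \<le> circle_mean_square f r"
  unfolding circle_mean_square_def set_lebesgue_integral_def
  by (intro divide_nonneg_pos Bochner_Integration.integral_nonneg) auto

lemma nn_integral_circle_mean_square:
  assumes "continuous_on (sphere 0 \<bar>r\<bar>) f"
  shows "(\<integral>\<^sup>+\<theta>. ennreal ((cmod (f (of_real r * cis \<theta>)))\<^sup>2) \<partial>angle_measure)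
    = ennreal (2 * pi * circle_mean_square f r)"
  unfolding circle_mean_square_eq_integral[OF assms]
  by (intro nn_integral_angle_continuous continuous_intros continuous_on_circle assms) auto

lemma nn_integral_circle_mean_square_holomorphic:
  assumes "f holomorphic_on unit_disc" "0 \<le> r" "r < 1"
  shows "(\<integral>\<^sup>+\<theta>. ennreal ((cmod (f (of_real r * cis \<theta>)))\<^sup>2) \<partial>angle_measure)
    = ennreal (2 * pi * circle_mean_square f r)"
  using assms
  by (intro nn_integral_circle_mean_square continuous_on_subset[OF holomorphic_on_imp_continuous_on[OF assms(1)]])
    auto

lemma has_integral_cis_int:
  "((\<lambda>t. cis (of_int k * t)) has_integral (if k = 0 then 2 * pi else 0)) {0..2 * pi}"
proof (cases "k = 0")
  case True
  have "((\<lambda>t. 1 :: complex) has_integral (2 * pi - 0) *\<^sub>R 1) {0..2 * pi}"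
    by (rule has_integral_const_real[THEN has_integral_eq_rhs]) auto
  then show ?thesis using True by (simp add: scaleR_conv_of_real)
next
  case False
  have "((\<lambda>t. cis (of_int k * t) / (\<i> * of_int k)) has_vector_derivative cis (of_int k * t))
          (at t within {0..2 * pi})" for t
  proof -
    have "((\<lambda>z. exp (\<i> * of_int k * z) / (\<i> * of_int k)) has_field_derivative exp (\<i> * of_int k * of_real t)) (at (of_real t))"
      using False by (auto intro!: derivative_eq_intros)
    from has_vector_derivative_real_field[OF this] show ?thesis
      by (simp add: cis_conv_exp mult.assoc has_vector_derivative_at_within)
  qed
  then have "((\<lambda>t. cis (of_int k * t)) has_integral
      (cis (of_int k * (2 * pi)) / (\<i> * of_int k) - cis (of_int k * 0) / (\<i> * of_int k))) {0..2 * pi}"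
    by (intro fundamental_theorem_of_calculus) auto
  moreover have "cis (of_int k * (2 * pi)) = 1"
    using cis_multiple_2pi[of "of_int k"] by (simp add: mult_ac)
  ultimately show ?thesis using False by simp
qed

lemma integral_trigonometric_polynomial:
  "integral {0..2 * pi} (\<lambda>t. (cmod (\<Sum>n<N. c n * cis (real n * t)))\<^sup>2) = 2 * pi * (\<Sum>n<N. (cmod (c n))\<^sup>2)"
proof -
  have eq: "of_real ((cmod (\<Sum>n<N. c n * cis (real n * t)))\<^sup>2)
      = (\<Sum>n<N. \<Sum>m<N. c n * cnj (c m) * cis (of_int (int n - int m) * t))" for t
  proof -
    have "cis (real n * t) * cnj (cis (real m * t)) = cis (of_int (int n - int m) * t)" for n m
      by (simp add: cis_cnj cis_mult algebra_simps)
    then have "(c n * cis (real n * t)) * cnj (c m * cis (real m * t)) =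
        c n * cnj (c m) * cis (of_int (int n - int m) * t)" for n m
      by (simp add: mult_ac)
    then show ?thesis
      by (simp only: complex_norm_square cnj_sum sum_product)
  qed
  have "((\<lambda>t. \<Sum>n<N. \<Sum>m<N. c n * cnj (c m) * cis (of_int (int n - int m) * t)) has_integral
      (\<Sum>n<N. \<Sum>m<N. c n * cnj (c m) * of_real (if int n - int m = 0 then 2 * pi else 0))) {0..2 * pi}"
    by (intro has_integral_sum has_integral_mult_right has_integral_cis_int) auto
  also have "(\<Sum>n<N. \<Sum>m<N. c n * cnj (c m) * of_real (if int n - int m = 0 then 2 * pi else 0))
      = (\<Sum>n<N. \<Sum>m<N. if m = n then of_real (2 * pi * (cmod (c n))\<^sup>2) else 0)"
    by (intro sum.cong refl) (auto simp flip: complex_norm_square)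
  also have "\<dots> = of_real (2 * pi * (\<Sum>n<N. (cmod (c n))\<^sup>2))"
    by (simp add: sum_distrib_left)
  finally have "((\<lambda>t. complex_of_real ((cmod (\<Sum>n<N. c n * cis (real n * t)))\<^sup>2)) has_integral
      of_real (2 * pi * (\<Sum>n<N. (cmod (c n))\<^sup>2))) {0..2 * pi}"
    unfolding eq .
  from has_integral_Re[OF this] show ?thesis by (simp add: integral_unique)
qed

text \<open>Parseval's identity on an inner circle, by dominated convergence from the finite case.
  It allows arbitrary coefficients a, so that it also applies to a remainder whose first
  coefficients are set to zero.\<close>

lemma circle_mean_square_sums:
  assumes a: "\<And>z. z \<in> unit_disc \<Longrightarrow> (\<lambda>n. a n * z ^ n) sums f z" and r: "0 \<le> r" "r < 1"
  shows "(\<lambda>n. (cmod (a n))\<^sup>2 * r ^ (2 * n)) sums circle_mean_square f r"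
proof -
  have f: "f holomorphic_on unit_disc"
    by (rule power_series_holomorphic[where a = a]) (use a in auto)
  define c where "c n = a n * of_real (r ^ n)" for n
  define g where "g N t = (\<Sum>n<N. c n * cis (real n * t))" for N t
  define S where "S = (\<Sum>n. cmod (c n))"
  \<comment> \<open>Convergence at a radius strictly between r and 1 gives absolute convergence at
    r, hence the constant dominating all partial sums.\<close>
  define s where "s = (1 + r) / 2"
  have s: "r < s" "s < 1" "0 \<le> s" using r by (auto simp: s_def)
  have "summable (\<lambda>n. a n * of_real s ^ n)"
    using a[of "of_real s"] s by (auto simp: sums_iff)
  then have summ: "summable (\<lambda>n. cmod (c n))"
    using powser_insidea[of a "of_real s" "of_real r"] r s by (simp add: c_def)
  have bound: "cmod (g N t) \<le> S" for N t
  proof -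
    have "cmod (g N t) \<le> (\<Sum>n<N. cmod (c n))"
      unfolding g_def by (rule order_trans[OF norm_sum]) (simp add: norm_mult)
    also have "\<dots> \<le> S" unfolding S_def by (intro sum_le_suminf summ) auto
    finally show ?thesis .
  qed
  have lim: "(\<lambda>N. g N t) \<longlonglongrightarrow> f (of_real r * cis t)" for t
    using a[of "of_real r * cis t"] r unfolding sums_def g_def c_def
    by (simp add: norm_mult power_mult_distrib Complex.DeMoivre mult_ac)
  have "(\<lambda>N. integral {0..2 * pi} (\<lambda>t. (cmod (g N t))\<^sup>2)) \<longlonglongrightarrow>
      integral {0..2 * pi} (\<lambda>t. (cmod (f (of_real r * cis t)))\<^sup>2)"
  proof (rule dominated_convergence(2)[where h = "\<lambda>_. S\<^sup>2"])
    show "(\<lambda>t. (cmod (g N t))\<^sup>2) integrable_on {0..2 * pi}" for N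
      unfolding g_def by (intro integrable_continuous_interval continuous_intros)
    show "(\<lambda>N. (cmod (g N t))\<^sup>2) \<longlonglongrightarrow> (cmod (f (of_real r * cis t)))\<^sup>2" for t
      by (intro tendsto_intros lim)
  qed (use bound in \<open>auto intro: power_mono\<close>)
  also have "integral {0..2 * pi} (\<lambda>t. (cmod (f (of_real r * cis t)))\<^sup>2) = 2 * pi * circle_mean_square f r"
    using r by (intro circle_mean_square_eq_integral[symmetric]
        continuous_on_subset[OF holomorphic_on_imp_continuous_on[OF f]]) auto
  finally have "(\<lambda>N. 2 * pi * (\<Sum>n<N. (cmod (c n))\<^sup>2)) \<longlonglongrightarrow> 2 * pi * circle_mean_square f r"
    by (simp only: g_def integral_trigonometric_polynomial)
  then have "(\<lambda>N. 1 / (2 * pi) * (2 * pi * (\<Sum>n<N. (cmod (c n))\<^sup>2))) \<longlonglongrightarrow> 1 / (2 * pi) * (2 * pi * circle_mean_square f r)"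
    by (rule tendsto_mult_left)
  then have "(\<lambda>n. (cmod (c n))\<^sup>2) sums circle_mean_square f r"
    by (simp add: sums_def)
  then show ?thesis
    using r by (simp add: c_def norm_mult power_mult_distrib norm_power power_mult[symmetric] mult.commute)
qed

section \<open>Taylor coefficients and the Hardy norm\<close>

definition taylor_coeff :: "(complex \<Rightarrow> complex) \<Rightarrow> nat \<Rightarrow> complex" where
  "taylor_coeff f n = (deriv ^^ n) f 0 / fact n"

definition taylor_poly :: "nat \<Rightarrow> (complex \<Rightarrow> complex) \<Rightarrow> complex \<Rightarrow> complex" where
  "taylor_poly N f z = (\<Sum>n<N. taylor_coeff f n * z ^ n)"

lemma taylor_coeff_sums:
  assumes "f holomorphic_on unit_disc" "z \<in> unit_disc"
  shows "(\<lambda>n. taylor_coeff f n * z ^ n) sums f z"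
  using holomorphic_power_series[OF assms] by (simp add: taylor_coeff_def)

lemma taylor_poly_holomorphic [holomorphic_intros]:
  assumes "g holomorphic_on S"
  shows "(\<lambda>z. taylor_poly N f (g z)) holomorphic_on S"
  unfolding taylor_poly_def by (intro holomorphic_intros assms)

lemma continuous_on_taylor_poly [continuous_intros]:
  fixes g :: "'a :: topological_space \<Rightarrow> complex"
  assumes "continuous_on S g"
  shows "continuous_on S (\<lambda>z. taylor_poly N f (g z))"
  unfolding taylor_poly_def by (intro continuous_intros assms)

lemma hardy2_norm_squared:
  assumes "f \<in> hardy2"
  shows "(hardy2_norm f)\<^sup>2 = (SUP r\<in>{0..<1}. circle_mean_square f r)"
proof -
  have "0 \<le> (SUP r\<in>{0..<1}. circle_mean_square f r)"
    using assms circle_mean_square_nonneg[of f 0] by (intro cSUP_upper2[where x = 0]) (auto simp: hardy2_def)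
  then show ?thesis by (simp add: hardy2_norm_def)
qed

lemma hardy2_circle_mean_square_le:
  assumes "f \<in> hardy2" "0 \<le> r" "r < 1"
  shows "circle_mean_square f r \<le> (hardy2_norm f)\<^sup>2"
  unfolding hardy2_norm_squared[OF assms(1)]
  using assms by (intro cSUP_upper) (auto simp: hardy2_def)

lemma hardy2I:
  assumes "f holomorphic_on unit_disc" and "\<And>r. 0 \<le> r \<Longrightarrow> r < 1 \<Longrightarrow> circle_mean_square f r \<le> B"
  shows "f \<in> hardy2" and "(hardy2_norm f)\<^sup>2 \<le> B"
proof -
  show *: "f \<in> hardy2" unfolding hardy2_def using assms by (auto intro!: bdd_aboveI2)
  show "(hardy2_norm f)\<^sup>2 \<le> B"
    unfolding hardy2_norm_squared[OF *] by (rule cSUP_least) (use assms(2) in auto)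
qed

text \<open>A finite sum can follow r to 1 in Parseval's identity term by term, and the resulting
  bound does not depend on its length.\<close>

lemma hardy2_taylor_coeff:
  assumes f: "f \<in> hardy2"
  shows "summable (\<lambda>n. (cmod (taylor_coeff f n))\<^sup>2)"
    and "(\<Sum>n. (cmod (taylor_coeff f n))\<^sup>2) \<le> (hardy2_norm f)\<^sup>2"
proof -
  have hol: "f holomorphic_on unit_disc" using f by (simp add: hardy2_def)
  have bound: "(\<Sum>n<N. (cmod (taylor_coeff f n))\<^sup>2) \<le> (hardy2_norm f)\<^sup>2" for N
  proof (rule tendsto_le)
    show "((\<lambda>r. \<Sum>n<N. (cmod (taylor_coeff f n))\<^sup>2 * r ^ (2 * n)) \<longlongrightarrow> (\<Sum>n<N. (cmod (taylor_coeff f n))\<^sup>2)) (at_left 1)"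
      by (auto intro!: tendsto_eq_intros)
    have "\<forall>\<^sub>F r :: real in at_left 1. r \<in> {0<..<1}"
      by (rule eventually_at_left_real) simp
    then show "\<forall>\<^sub>F r in at_left 1. (\<Sum>n<N. (cmod (taylor_coeff f n))\<^sup>2 * r ^ (2 * n)) \<le> (hardy2_norm f)\<^sup>2"
    proof eventually_elim
      case (elim r)
      then have S: "(\<lambda>n. (cmod (taylor_coeff f n))\<^sup>2 * r ^ (2 * n)) sums circle_mean_square f r"
        by (intro circle_mean_square_sums taylor_coeff_sums hol) auto
      have "(\<Sum>n<N. (cmod (taylor_coeff f n))\<^sup>2 * r ^ (2 * n)) \<le> circle_mean_square f r"
        unfolding sums_unique[OF S] by (intro sum_le_suminf sums_summable[OF S]) (use elim in auto)
      also have "\<dots> \<le> (hardy2_norm f)\<^sup>2"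
        using elim by (intro hardy2_circle_mean_square_le f) auto
      finally show ?case .
    qed
  qed auto
  show "summable (\<lambda>n. (cmod (taylor_coeff f n))\<^sup>2)"
    by (rule summableI_nonneg_bounded[OF _ bound]) auto
  then show "(\<Sum>n. (cmod (taylor_coeff f n))\<^sup>2) \<le> (hardy2_norm f)\<^sup>2"
    by (rule suminf_le_const) (rule bound)
qed

text \<open>This bounds the mean squares of the Taylor remainder uniformly in the radius; density of
  polynomials enters the proof only as its convergence to 0.\<close>

definition hardy2_tail :: "nat \<Rightarrow> (complex \<Rightarrow> complex) \<Rightarrow> real" where
  "hardy2_tail N f = (\<Sum>n. (cmod (taylor_coeff f (n + N)))\<^sup>2)"

lemma hardy2_tail_tendsto: "f \<in> hardy2 \<Longrightarrow> (\<lambda>N. hardy2_tail N f) \<longlonglongrightarrow> 0"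
  unfolding hardy2_tail_def using suminf_exist_split2[OF hardy2_taylor_coeff(1)] by simp

lemma hardy2_tail_nonneg: "f \<in> hardy2 \<Longrightarrow> 0 \<le> hardy2_tail N f"
  unfolding hardy2_tail_def
  by (intro suminf_nonneg summable_ignore_initial_segment hardy2_taylor_coeff(1)) auto

lemma circle_mean_square_taylor_remainder:
  assumes f: "f \<in> hardy2" and r: "0 \<le> r" "r < 1"
  shows "circle_mean_square (\<lambda>z. f z - taylor_poly N f z) r \<le> hardy2_tail N f"
proof -
  have hol: "f holomorphic_on unit_disc" using f by (simp add: hardy2_def)
  \<comment> \<open>The remainder has the power series of f with its first N coefficients erased.
    Parseval applies to it, and dropping the powers of r gives the tail.\<close>
  let ?a = "\<lambda>n. if n < N then 0 else taylor_coeff f n"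
  have "(\<lambda>n. ?a n * z ^ n) sums (f z - taylor_poly N f z)" if "z \<in> unit_disc" for z
  proof -
    have "(\<lambda>n. if n < N then taylor_coeff f n * z ^ n else 0) sums taylor_poly N f z"
      unfolding taylor_poly_def
      using sums_If_finite_set[of "{..<N}" "\<lambda>n. taylor_coeff f n * z ^ n"] by (simp add: lessThan_iff)
    from sums_diff[OF taylor_coeff_sums[OF hol that] this] show ?thesis
      by (rule sums_cong[THEN iffD1, rotated]) auto
  qed
  from circle_mean_square_sums[OF this r]
  have S: "(\<lambda>n. (cmod (?a n))\<^sup>2 * r ^ (2 * n)) sums circle_mean_square (\<lambda>z. f z - taylor_poly N f z) r" .
  then have "(\<lambda>n. (cmod (?a (n + N)))\<^sup>2 * r ^ (2 * (n + N))) sums circle_mean_square (\<lambda>z. f z - taylor_poly N f z) r"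
    by (subst sums_zero_iff_shift) auto
  then show ?thesis
    unfolding hardy2_tail_def
    by (rule sums_le[OF _ _ summable_sums[OF summable_ignore_initial_segment[OF hardy2_taylor_coeff(1)[OF f]]], rotated])
       (use r in \<open>auto intro!: mult_left_le power_le_one\<close>)
qed

lemma circle_mean_square_taylor_poly:
  "circle_mean_square (taylor_poly N f) 1 = (\<Sum>n<N. (cmod (taylor_coeff f n))\<^sup>2)"
proof -
  have "2 * pi * circle_mean_square (taylor_poly N f) 1
      = integral {0..2 * pi} (\<lambda>\<theta>. (cmod (taylor_poly N f (of_real 1 * cis \<theta>)))\<^sup>2)"
    by (intro circle_mean_square_eq_integral continuous_intros)
  also have "\<dots> = 2 * pi * (\<Sum>n<N. (cmod (taylor_coeff f n))\<^sup>2)"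
    unfolding integral_trigonometric_polynomial[symmetric] by (simp add: taylor_poly_def Complex.DeMoivre)
  finally show ?thesis by simp
qed

section \<open>Radial limits\<close>

text \<open>One fixed sequence of radii serves for dilations, for measurability of limits and for
  Fatou's lemma. The offset 2 makes even the first radius positive, so that dilations can be
  inverted.\<close>

definition boundary_radius :: "nat \<Rightarrow> real" where
  "boundary_radius n = 1 - 1 / real (n + 2)"

lemma boundary_radius: "0 < boundary_radius n" "0 \<le> boundary_radius n" "boundary_radius n < 1"
  by (auto simp: boundary_radius_def field_simps)

lemma boundary_radius_mono: "m \<le> n \<Longrightarrow> boundary_radius m \<le> boundary_radius n"
  by (simp add: boundary_radius_def frac_le)

lemma boundary_radius_at_left: "filterlim boundary_radius (at_left 1) sequentially"
  unfolding boundary_radius_def by real_asymp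

text \<open>Dilating by \<open>\<rho> n\<close> gives a function holomorphic on the closed disc, and
  a radius below \<open>\<rho> n\<close> for \<open>q\<close> becomes one below 1 for the dilate.
  The bounds are uniform in n and the sets increase to \<open>E\<close>. The constant 30 pi is 15
  times the length 2 pi of the circle.\<close>

lemma radial_maximal_weak_type:
  assumes q: "q holomorphic_on unit_disc"
    and B: "\<And>r. 0 \<le> r \<Longrightarrow> r < 1 \<Longrightarrow> circle_mean_square q r \<le> B" and "0 < \<alpha>"
  defines "E \<equiv> {\<theta> \<in> {0..2 * pi}. \<exists>r\<ge>0. r < 1 \<and> \<alpha> < (cmod (q (of_real r * cis \<theta>)))\<^sup>2}"
  shows "E \<in> sets borel" and "emeasure lborel E \<le> ennreal (30 * pi * B / \<alpha>)"
proof -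
  define \<rho> where "\<rho> = boundary_radius"
  have \<rho>: "0 < \<rho> n" "\<rho> n < 1" for n by (simp_all add: \<rho>_def boundary_radius)
  define E' where "E' n = {0..2 * pi} \<inter> (\<Union>r\<in>{0..<\<rho> n}. {\<theta>. \<alpha> < (cmod (q (of_real r * cis \<theta>)))\<^sup>2})" for n
  have E'_borel: "E' n \<in> sets borel" for n
  proof -
    \<comment> \<open>The union over radii is uncountable, but each member is open by continuity, so
      the union is still Borel.\<close>
    have "open (\<Union>r\<in>{0..<\<rho> n}. {\<theta>. \<alpha> < (cmod (q (of_real r * cis \<theta>)))\<^sup>2})"
      using \<rho>(2)[of n]
      by (intro open_UN ballI open_Collect_less continuous_intros continuous_on_circle_holomorphic q) auto
    then show ?thesis unfolding E'_def by auto
  qed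
  have "\<rho> \<longlonglongrightarrow> 1"
    using boundary_radius_at_left by (simp add: \<rho>_def filterlim_at)
  have E: "E = (\<Union>n. E' n)"
  proof
    show "E \<subseteq> (\<Union>n. E' n)"
    proof
      fix \<theta> assume "\<theta> \<in> E"
      then obtain r where r: "\<theta> \<in> {0..2 * pi}" "0 \<le> r" "r < 1" "\<alpha> < (cmod (q (of_real r * cis \<theta>)))\<^sup>2"
        unfolding E_def by auto
      obtain n where "r < \<rho> n"
        using order_tendstoD(1)[OF \<open>\<rho> \<longlonglongrightarrow> 1\<close> r(3)] by (auto simp: eventually_sequentially)
      then have "\<theta> \<in> E' n" using r unfolding E'_def by auto
      then show "\<theta> \<in> (\<Union>n. E' n)" by blast
    qed
    show "(\<Union>n. E' n) \<subseteq> E" unfolding E_def E'_def by (fastforce dest: less_trans[OF _ \<rho>(2)])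
  qed
  show "E \<in> sets borel" unfolding E using E'_borel by auto
  have bound: "emeasure lborel (E' n) \<le> ennreal (30 * pi * B / \<alpha>)" for n
  proof -
    define q' where "q' z = q (of_real (\<rho> n) * z)" for z
    have "cmod (of_real (\<rho> n) * z) < 1" if "cmod z \<le> 1" for z
    proof -
      have "\<rho> n * cmod z \<le> \<rho> n * 1" using \<rho>(1)[of n] that by (intro mult_left_mono) auto
      then have "\<rho> n * cmod z < 1" using \<rho>(2)[of n] by linarith
      then show ?thesis using \<rho>(1)[of n] by (simp only: norm_mult norm_of_real abs_of_pos)
    qed
    then have "q' holomorphic_on cball 0 1"
      unfolding q'_def
      by (intro holomorphic_on_compose_gen[OF _ q, unfolded o_def] holomorphic_intros) auto
    then have "emeasure lborel (E' n) \<le> ennreal (15 / \<alpha> * integral {0..2 * pi} (\<lambda>t. (cmod (q' (cis t)))\<^sup>2))"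
    proof (rule radial_maximal_weak_type_dilate[OF _ \<open>0 < \<alpha>\<close>])
      fix \<theta> assume "\<theta> \<in> E' n"
      then obtain r where "0 \<le> r" "r < \<rho> n" "\<alpha> < (cmod (q (of_real r * cis \<theta>)))\<^sup>2"
        unfolding E'_def by auto
      then show "\<exists>r\<ge>0. r < 1 \<and> \<alpha> < (cmod (q' (of_real r * cis \<theta>)))\<^sup>2"
        using \<rho>(1)[of n] by (intro exI[of _ "r / \<rho> n"]) (simp add: q'_def mult.assoc[symmetric])
    qed (auto simp: E'_def)
    also have "integral {0..2 * pi} (\<lambda>t. (cmod (q' (cis t)))\<^sup>2) = 2 * pi * circle_mean_square q (\<rho> n)"
      unfolding q'_def using \<rho>[of n]
      by (intro circle_mean_square_eq_integral[symmetric]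
        continuous_on_subset[OF holomorphic_on_imp_continuous_on[OF q]]) auto
    also have "ennreal (15 / \<alpha> * \<dots>) \<le> ennreal (30 * pi * B / \<alpha>)"
      using mult_left_mono[OF B[of "\<rho> n"], of "30 * pi / \<alpha>"] \<rho>[of n] \<open>0 < \<alpha>\<close>
      by (intro ennreal_leI) simp
    finally show ?thesis .
  qed
  have "{0..<\<rho> m} \<subseteq> {0..<\<rho> n}" if "m \<le> n" for m n
    using boundary_radius_mono[OF that] by (auto simp: \<rho>_def)
  then have "incseq E'"
    unfolding E'_def incseq_def by (intro allI impI Int_mono UN_mono) auto
  then have "emeasure lborel E = (SUP n. emeasure lborel (E' n))"
    unfolding E using E'_borel by (intro SUP_emeasure_incseq[symmetric]) auto
  then show "emeasure lborel E \<le> ennreal (30 * pi * B / \<alpha>)"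
    using bound by (simp add: SUP_le_iff)
qed

section \<open>Fatou's theorem: existence of radial limits\<close>

lemma tendsto_at_left_if_Cauchy:
  fixes g :: "real \<Rightarrow> 'a :: complete_space"
  assumes "\<And>\<epsilon>. 0 < \<epsilon> \<Longrightarrow> \<exists>s<b. \<forall>r\<in>{s<..<b}. \<forall>r'\<in>{s<..<b}. dist (g r) (g r') \<le> \<epsilon>"
  shows "\<exists>L. (g \<longlongrightarrow> L) (at_left b)"
proof -
  define \<rho> where "\<rho> n = b - 1 / real (Suc n)" for n
  have \<rho>: "\<rho> \<longlonglongrightarrow> b" unfolding \<rho>_def by real_asymp
  have \<rho>_less: "\<rho> n < b" for n by (simp add: \<rho>_def)
  have ev: "\<forall>\<^sub>F n in sequentially. \<rho> n \<in> {s<..<b}" if "s < b" for s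
    using order_tendstoD(1)[OF \<rho> that] \<rho>_less by simp
  have "Cauchy (\<lambda>n. g (\<rho> n))"
  proof (rule metric_CauchyI)
    fix e :: real assume "0 < e"
    then obtain s where s: "s < b" "\<forall>r\<in>{s<..<b}. \<forall>r'\<in>{s<..<b}. dist (g r) (g r') \<le> e / 2"
      using assms[of "e / 2"] by auto
    from ev[OF s(1)] obtain M where "\<And>n. n \<ge> M \<Longrightarrow> \<rho> n \<in> {s<..<b}"
      by (auto simp: eventually_sequentially)
    note M = this
    show "\<exists>M. \<forall>m\<ge>M. \<forall>n\<ge>M. dist (g (\<rho> m)) (g (\<rho> n)) < e"
    proof (intro exI[of _ M] allI impI)
      fix m n assume "M \<le> m" "M \<le> n"
      then have "dist (g (\<rho> m)) (g (\<rho> n)) \<le> e / 2" using s(2) M by blast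
      then show "dist (g (\<rho> m)) (g (\<rho> n)) < e" using \<open>0 < e\<close> by linarith
    qed
  qed
  then obtain L where L: "(\<lambda>n. g (\<rho> n)) \<longlonglongrightarrow> L" by (metis Cauchy_convergent convergent_def)
  have "(g \<longlongrightarrow> L) (at_left b)"
  proof (rule tendstoI)
    fix e :: real assume "0 < e"
    then obtain s where s: "s < b" "\<forall>r\<in>{s<..<b}. \<forall>r'\<in>{s<..<b}. dist (g r) (g r') \<le> e / 2"
      using assms[of "e / 2"] by auto
    have "\<forall>\<^sub>F r in at_left b. r \<in> {s<..<b}" using s(1) by (rule eventually_at_left_real)
    then show "\<forall>\<^sub>F r in at_left b. dist (g r) L < e"
    proof eventually_elim
      case (elim r)
      have "dist (g r) L \<le> e / 2"
      proof (rule tendsto_upperbound)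
        show "(\<lambda>n. dist (g r) (g (\<rho> n))) \<longlonglongrightarrow> dist (g r) L" by (intro tendsto_intros L)
        show "\<forall>\<^sub>F n in sequentially. dist (g r) (g (\<rho> n)) \<le> e / 2"
          using ev[OF s(1)] by eventually_elim (use s(2) elim in auto)
      qed simp
      then show ?case using \<open>0 < e\<close> by simp
    qed
  qed
  then show ?thesis by blast
qed

lemma AE_angle_measureI:
  assumes "N \<in> sets borel" "emeasure lborel N = 0" "\<And>\<theta>. \<theta> \<in> {0..2 * pi} \<Longrightarrow> \<theta> \<notin> N \<Longrightarrow> P \<theta>"
  shows "AE \<theta> in angle_measure. P \<theta>"
  unfolding AE_restrict_space_iff[of "{0..2 * pi}" lborel, simplified]
  by (rule AE_I'[of N]) (use assms in \<open>auto simp: null_sets_def\<close>)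

text \<open>Along a radius f is a polynomial, which is continuous, plus a remainder with small
  maximal function. By the weak-type inequality the set where the N-th remainder exceeds \<epsilon>
  has measure of order \<open>hardy2_tail N f\<close> over the square of \<epsilon>, so the points
  that are bad for every N form a null set. Elsewhere the oscillation near the boundary is at most
  \<epsilon> from the polynomial plus 2 \<epsilon> from the remainder.\<close>

theorem hardy2_radial_limit_exists:
  assumes f: "f \<in> hardy2"
  shows "AE \<theta> in angle_measure. \<exists>L. ((\<lambda>r. f (of_real r * cis \<theta>)) \<longlongrightarrow> L) (at_left 1)"
proof -
  have hol: "f holomorphic_on unit_disc" using f by (simp add: hardy2_def)
  have "AE \<theta> in angle_measure. \<exists>s<1. \<forall>r\<in>{s<..<1}. \<forall>r'\<in>{s<..<1}.
          dist (f (of_real r * cis \<theta>)) (f (of_real r' * cis \<theta>)) \<le> 3 * \<epsilon>"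
    if \<epsilon>: "0 < \<epsilon>" for \<epsilon>
  proof -
    define q where "q N z = f z - taylor_poly N f z" for N z
    define E where "E N = {\<theta> \<in> {0..2 * pi}. \<exists>r\<ge>0. r < 1 \<and> \<epsilon>\<^sup>2 < (cmod (q N (of_real r * cis \<theta>)))\<^sup>2}" for N
    have qhol: "q N holomorphic_on unit_disc" for N
      unfolding q_def by (intro holomorphic_intros hol)
    have qle: "circle_mean_square (q N) r \<le> hardy2_tail N f" if "0 \<le> r" "r < 1" for N r
      unfolding q_def using circle_mean_square_taylor_remainder[OF f that] .
    have E[measurable]: "E N \<in> sets borel"
      and weak: "emeasure lborel (E N) \<le> ennreal (30 * pi * hardy2_tail N f / \<epsilon>\<^sup>2)" for N
      unfolding E_def using \<epsilon>
      by (intro radial_maximal_weak_type(1)[OF qhol qle] radial_maximal_weak_type(2)[OF qhol qle]; simp)+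
    \<comment> \<open>One good N per point is enough, so only the intersection has to be null, and
      no summability of the tails in N is required.\<close>
    have "emeasure lborel (\<Inter>N. E N) \<le> ennreal (30 * pi * hardy2_tail N f / \<epsilon>\<^sup>2)" for N
      by (rule order_trans[OF emeasure_mono weak[of N]]) auto
    moreover have "(\<lambda>N. ennreal (30 * pi * hardy2_tail N f / \<epsilon>\<^sup>2)) \<longlonglongrightarrow> ennreal (30 * pi * 0 / \<epsilon>\<^sup>2)"
      using \<epsilon> by (intro tendsto_intros hardy2_tail_tendsto f) auto
    ultimately have "emeasure lborel (\<Inter>N. E N) \<le> ennreal (30 * pi * 0 / \<epsilon>\<^sup>2)"
      by (intro LIMSEQ_le_const) auto
    then have null: "emeasure lborel (\<Inter>N. E N) = 0" by simp
    show ?thesis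
    proof (rule AE_angle_measureI[OF _ null])
      show "(\<Inter>N. E N) \<in> sets borel" by measurable
      fix \<theta> assume "\<theta> \<in> {0..2 * pi}" "\<theta> \<notin> (\<Inter>N. E N)"
      then obtain N where "\<theta> \<notin> E N" by blast
      have N: "(cmod (q N (of_real r * cis \<theta>)))\<^sup>2 \<le> \<epsilon>\<^sup>2" if "0 \<le> r" "r < 1" for r
      proof (rule ccontr)
        assume "\<not> ?thesis"
        with that \<open>\<theta> \<in> {0..2 * pi}\<close> have "\<theta> \<in> E N"
          unfolding E_def mem_Collect_eq by (intro conjI exI[of _ r]) simp_all
        with \<open>\<theta> \<notin> E N\<close> show False by blast
      qed
      have q: "cmod (q N (of_real r * cis \<theta>)) \<le> \<epsilon>" if "0 \<le> r" "r < 1" for r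
        by (rule power2_le_imp_le[OF N[OF that]]) (use \<epsilon> in simp)
      define p where "p r = taylor_poly N f (of_real r * cis \<theta>)" for r
      have "(p \<longlongrightarrow> p 1) (at_left 1)"
        unfolding p_def by (intro continuous_on_tendsto_compose[of UNIV "taylor_poly N f"] continuous_intros tendsto_intros) auto
      from tendstoD[OF this, of "\<epsilon> / 2"] \<epsilon> obtain s where s: "s < 1" "\<And>r. s < r \<Longrightarrow> r < 1 \<Longrightarrow> dist (p r) (p 1) < \<epsilon> / 2"
        unfolding eventually_at_left_field by auto
      show "\<exists>s<1. \<forall>r\<in>{s<..<1}. \<forall>r'\<in>{s<..<1}.
          dist (f (of_real r * cis \<theta>)) (f (of_real r' * cis \<theta>)) \<le> 3 * \<epsilon>"
      \<comment> \<open>The remainder is controlled only at nonnegative radii, whence the maximum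
        with 0.\<close>
      proof (intro exI[of _ "max 0 s"] conjI ballI)
        fix r r' assume r: "r \<in> {max 0 s<..<1}" "r' \<in> {max 0 s<..<1}"
        have fpq: "f (of_real x * cis \<theta>) = p x + q N (of_real x * cis \<theta>)" for x
          by (simp add: p_def q_def)
        have "dist (p r) (p r') \<le> dist (p r) (p 1) + dist (p r') (p 1)" by (rule dist_triangle2)
        also have "\<dots> \<le> \<epsilon>" using s(2)[of r] s(2)[of r'] r by simp
        finally have "dist (p r) (p r') \<le> \<epsilon>" .
        moreover have "dist (q N (of_real r * cis \<theta>)) (q N (of_real r' * cis \<theta>)) \<le> \<epsilon> + \<epsilon>"
          unfolding dist_norm using r
          by (intro order_trans[OF norm_triangle_ineq4] add_mono q) auto
        ultimately show "dist (f (of_real r * cis \<theta>)) (f (of_real r' * cis \<theta>)) \<le> 3 * \<epsilon>"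
          unfolding fpq by (intro order_trans[OF dist_triangle_add]) linarith
      qed (use s in auto)
    qed
  qed
  \<comment> \<open>The exceptional null set depends on \<epsilon>; restricting to countably many
    values yields a common one.\<close>
  then have "AE \<theta> in angle_measure. \<forall>k. \<exists>s<1. \<forall>r\<in>{s<..<1}. \<forall>r'\<in>{s<..<1}.
          dist (f (of_real r * cis \<theta>)) (f (of_real r' * cis \<theta>)) \<le> 3 * inverse (real (Suc k))"
    unfolding AE_all_countable by simp
  then show ?thesis
  proof eventually_elim
    case (elim \<theta>)
    show ?case
    proof (rule tendsto_at_left_if_Cauchy)
      fix \<epsilon> :: real assume "0 < \<epsilon>"
      then obtain k where "inverse (real (Suc k)) < \<epsilon> / 3" using reals_Archimedean[of "\<epsilon> / 3"] by auto
      then have k: "3 * inverse (real (Suc k)) \<le> \<epsilon>" by simp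
      from spec[OF elim, of k] obtain s where s: "s < 1"
        "\<forall>r\<in>{s<..<1}. \<forall>r'\<in>{s<..<1}.
          dist (f (of_real r * cis \<theta>)) (f (of_real r' * cis \<theta>)) \<le> 3 * inverse (real (Suc k))"
        by (elim exE conjE)
      show "\<exists>s<1. \<forall>r\<in>{s<..<1}. \<forall>r'\<in>{s<..<1}.
          dist (f (of_real r * cis \<theta>)) (f (of_real r' * cis \<theta>)) \<le> \<epsilon>"
        by (intro exI[of _ s] conjI ballI s(1) order_trans[OF s(2)[rule_format] k])
    qed
  qed
qed

section \<open>Boundary values compared with mean squares\<close>

lemma ennreal_weighted_sum:
  assumes "0 \<le> a" "0 \<le> b" "0 \<le> x" "0 \<le> y"
  shows "ennreal (a * x + b * y) = ennreal a * ennreal x + ennreal b * ennreal y"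
  using assms by (simp add: ennreal_mult)

text \<open>A Borel representative of the radial limit function, which need not itself be Borel.\<close>

definition boundary_value :: "(complex \<Rightarrow> complex) \<Rightarrow> real \<Rightarrow> complex" where
  "boundary_value f \<theta> = lim (\<lambda>n. f (of_real (boundary_radius n) * cis \<theta>))"

lemma boundary_value_eqI:
  assumes "((\<lambda>r. f (of_real r * cis \<theta>)) \<longlongrightarrow> L) (at_left 1)"
  shows "boundary_value f \<theta> = L"
  unfolding boundary_value_def
  by (intro limI filterlim_compose[OF assms boundary_radius_at_left])

lemma radial_limit_eqI:
  assumes "((\<lambda>r. f (of_real r * cis \<theta>)) \<longlongrightarrow> L) (at_left 1)"
  shows "radial_limit f (cis \<theta>) = L"
  unfolding radial_limit_def by (intro tendsto_Lim assms) simp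

lemma continuous_on_imp_angle_measurable:
  fixes u :: "real \<Rightarrow> 'b :: topological_space"
  assumes "continuous_on {0..2 * pi} u"
  shows "u \<in> borel_measurable angle_measure"
proof -
  have "measurable angle_measure (borel :: 'b measure) = measurable (restrict_space borel {0..2 * pi}) borel"
    by (intro measurable_cong_sets sets_restrict_space_cong) simp_all
  then show ?thesis using borel_measurable_continuous_on_restrict[OF assms] by (simp only:)
qed

lemma boundary_value_measurable:
  assumes "f holomorphic_on unit_disc"
  shows "boundary_value f \<in> borel_measurable angle_measure"
  unfolding boundary_value_def[abs_def]
  by (intro borel_measurable_lim_metric continuous_on_imp_angle_measurable
      continuous_on_circle_holomorphic assms boundary_radius)

lemma hardy2_boundary_value:
  assumes "f \<in> hardy2"
  shows "AE \<theta> in angle_measure. ((\<lambda>r. f (of_real r * cis \<theta>)) \<longlongrightarrow> boundary_value f \<theta>) (at_left 1)"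
  using hardy2_radial_limit_exists[OF assms] by eventually_elim (auto dest: boundary_value_eqI)

text \<open>Fatou's lemma along \<open>boundary_radius\<close>. A free bound B in place of the norm
  lets tail estimates and the subordination bound be inserted directly.\<close>

lemma nn_integral_boundary_value_le:
  assumes f: "f \<in> hardy2" and B: "\<And>r. 0 \<le> r \<Longrightarrow> r < 1 \<Longrightarrow> circle_mean_square f r \<le> B"
  shows "(\<integral>\<^sup>+\<theta>. ennreal ((cmod (boundary_value f \<theta>))\<^sup>2) \<partial>angle_measure) \<le> ennreal (2 * pi * B)"
proof -
  have hol: "f holomorphic_on unit_disc" using f by (simp add: hardy2_def)
  define F where "F n \<theta> = ennreal ((cmod (f (of_real (boundary_radius n) * cis \<theta>)))\<^sup>2)" for n \<theta>
  have [measurable]: "(\<lambda>\<theta>. f (of_real (boundary_radius n) * cis \<theta>)) \<in> borel_measurable angle_measure" for n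
    by (intro continuous_on_imp_angle_measurable continuous_on_circle_holomorphic hol boundary_radius)
  have "AE \<theta> in angle_measure. ennreal ((cmod (boundary_value f \<theta>))\<^sup>2) = liminf (\<lambda>n. F n \<theta>)"
    using hardy2_boundary_value[OF f]
  proof eventually_elim
    case (elim \<theta>)
    have "(\<lambda>n. F n \<theta>) \<longlonglongrightarrow> ennreal ((cmod (boundary_value f \<theta>))\<^sup>2)"
      unfolding F_def by (intro tendsto_intros filterlim_compose[OF elim boundary_radius_at_left])
    then show ?case by (metis lim_imp_Liminf sequentially_bot)
  qed
  then have "(\<integral>\<^sup>+\<theta>. ennreal ((cmod (boundary_value f \<theta>))\<^sup>2) \<partial>angle_measure) = (\<integral>\<^sup>+\<theta>. liminf (\<lambda>n. F n \<theta>) \<partial>angle_measure)"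
    by (rule nn_integral_cong_AE)
  also have "\<dots> \<le> liminf (\<lambda>n. \<integral>\<^sup>+\<theta>. F n \<theta> \<partial>angle_measure)"
    unfolding F_def by (intro nn_integral_liminf) measurable
  also have "\<dots> \<le> liminf (\<lambda>n. ennreal (2 * pi * B))"
    unfolding F_def nn_integral_circle_mean_square_holomorphic[OF hol boundary_radius(2,3)]
    by (intro Liminf_mono always_eventually allI ennreal_leI mult_left_mono B boundary_radius) auto
  finally show ?thesis by (simp add: Liminf_const)
qed

text \<open>The triangle inequality with 2ab at most \<epsilon> times the square of a plus
  1/\<epsilon> times the square of b. The coefficient of the main term tends to 1 with \<epsilon>,
  so that a vanishing error costs nothing in the limit.\<close>

lemma norm_squared_le_weighted:
  fixes x y :: complex
  assumes "0 < \<epsilon>"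
  shows "(cmod x)\<^sup>2 \<le> (1 + \<epsilon>) * (cmod y)\<^sup>2 + (1 + 1 / \<epsilon>) * (cmod (y - x))\<^sup>2"
proof -
  have "cmod x \<le> cmod y + cmod (y - x)"
    by (metis add.commute norm_minus_commute norm_triangle_sub)
  then have "(cmod x)\<^sup>2 \<le> (cmod y + cmod (y - x))\<^sup>2" by (intro power_mono) auto
  also have "\<dots> = (cmod y)\<^sup>2 + (cmod (y - x))\<^sup>2 + 2 * cmod y * cmod (y - x)"
    by (simp add: power2_sum)
  also have "2 * cmod y * cmod (y - x) \<le> \<epsilon> * (cmod y)\<^sup>2 + 1 / \<epsilon> * (cmod (y - x))\<^sup>2"
  proof -
    have "0 \<le> (\<epsilon> * cmod y - cmod (y - x))\<^sup>2 / \<epsilon>" using assms by simp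
    also have "\<dots> = \<epsilon> * (cmod y)\<^sup>2 + 1 / \<epsilon> * (cmod (y - x))\<^sup>2 - 2 * cmod y * cmod (y - x)"
      using assms by (simp add: power2_eq_square field_simps)
    finally show ?thesis by simp
  qed
  finally show ?thesis by (simp add: algebra_simps)
qed

text \<open>The direction that Fatou's lemma does not give, and the one that transfers boundary
  information into the disc. A partial sum of squared coefficients is the mean square of a Taylor
  polynomial on the circle itself, and there the polynomial is the boundary value of k minus that of
  the remainder, whose integral is at most a multiple of the tail.\<close>

theorem circle_mean_square_le_boundary:
  assumes k: "k \<in> hardy2" and r: "0 \<le> r" "r < 1"
  shows "ennreal (2 * pi * circle_mean_square k r)
    \<le> (\<integral>\<^sup>+\<theta>. ennreal ((cmod (boundary_value k \<theta>))\<^sup>2) \<partial>angle_measure)" (is "_ \<le> ?J")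
proof -
  have hol: "k holomorphic_on unit_disc" using k by (simp add: hardy2_def)
  let ?a = "\<lambda>n. (cmod (taylor_coeff k n))\<^sup>2"
  have "?J \<le> ennreal (2 * pi * (hardy2_norm k)\<^sup>2)"
    by (intro nn_integral_boundary_value_le k hardy2_circle_mean_square_le)
  then have "?J \<noteq> top" by (auto simp: top_unique)
  then obtain j where j: "?J = ennreal j" "0 \<le> j" by (cases ?J) auto
  have partial: "2 * pi * (\<Sum>n<N. ?a n) \<le> (1 + \<epsilon>) * j + (1 + 1 / \<epsilon>) * (2 * pi * hardy2_tail N k)"
    if \<epsilon>: "0 < \<epsilon>" for \<epsilon> N
  proof -
    define q where "q z = k z - taylor_poly N k z" for z
    have qhol: "q holomorphic_on unit_disc" unfolding q_def by (intro holomorphic_intros hol)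
    have qle: "circle_mean_square q r \<le> hardy2_tail N k" if "0 \<le> r" "r < 1" for r
      unfolding q_def using circle_mean_square_taylor_remainder[OF k that] .
    have q: "q \<in> hardy2" by (rule hardy2I[OF qhol qle])
    have [measurable]: "boundary_value k \<in> borel_measurable angle_measure" "boundary_value q \<in> borel_measurable angle_measure"
      by (intro boundary_value_measurable hol qhol)+
    have "ennreal (2 * pi * (\<Sum>n<N. ?a n)) = (\<integral>\<^sup>+\<theta>. ennreal ((cmod (taylor_poly N k (of_real 1 * cis \<theta>)))\<^sup>2) \<partial>angle_measure)"
      unfolding circle_mean_square_taylor_poly[symmetric]
      by (intro nn_integral_circle_mean_square[symmetric] continuous_intros)
    also have "\<dots> \<le> (\<integral>\<^sup>+\<theta>. ennreal (1 + \<epsilon>) * ennreal ((cmod (boundary_value k \<theta>))\<^sup>2)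
        + ennreal (1 + 1 / \<epsilon>) * ennreal ((cmod (boundary_value q \<theta>))\<^sup>2) \<partial>angle_measure)"
    proof (rule nn_integral_mono_AE)
      show "AE \<theta> in angle_measure. ennreal ((cmod (taylor_poly N k (of_real 1 * cis \<theta>)))\<^sup>2)
          \<le> ennreal (1 + \<epsilon>) * ennreal ((cmod (boundary_value k \<theta>))\<^sup>2)
            + ennreal (1 + 1 / \<epsilon>) * ennreal ((cmod (boundary_value q \<theta>))\<^sup>2)"
        using hardy2_boundary_value[OF k]
      proof eventually_elim
        case (elim \<theta>)
        have "((\<lambda>r. taylor_poly N k (of_real r * cis \<theta>)) \<longlongrightarrow> taylor_poly N k (of_real 1 * cis \<theta>)) (at_left 1)"
          by (intro continuous_on_tendsto_compose[of UNIV "taylor_poly N k"] continuous_intros tendsto_intros) auto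
        from tendsto_diff[OF elim this]
        have "boundary_value q \<theta> = boundary_value k \<theta> - taylor_poly N k (of_real 1 * cis \<theta>)"
          by (intro boundary_value_eqI) (simp add: q_def)
        then have *: "(cmod (taylor_poly N k (of_real 1 * cis \<theta>)))\<^sup>2
          \<le> (1 + \<epsilon>) * (cmod (boundary_value k \<theta>))\<^sup>2 + (1 + 1 / \<epsilon>) * (cmod (boundary_value q \<theta>))\<^sup>2"
          using norm_squared_le_weighted[OF \<epsilon>] by (simp only:)
        then show ?case
          using \<epsilon> ennreal_leI[OF *] by (subst (asm) ennreal_weighted_sum) simp_all
      qed
    qed
    also have "\<dots> = ennreal (1 + \<epsilon>) * ?J + ennreal (1 + 1 / \<epsilon>) * (\<integral>\<^sup>+\<theta>. ennreal ((cmod (boundary_value q \<theta>))\<^sup>2) \<partial>angle_measure)"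
      by (subst nn_integral_add) (measurable, simp add: nn_integral_cmult)
    also have "\<dots> \<le> ennreal (1 + \<epsilon>) * ennreal j + ennreal (1 + 1 / \<epsilon>) * ennreal (2 * pi * hardy2_tail N k)"
      unfolding j(1) by (intro add_mono mult_left_mono order_refl nn_integral_boundary_value_le q qle) auto
    also have "\<dots> = ennreal ((1 + \<epsilon>) * j + (1 + 1 / \<epsilon>) * (2 * pi * hardy2_tail N k))"
      using \<epsilon> j hardy2_tail_nonneg[OF k, of N] by (intro ennreal_weighted_sum[symmetric]) simp_all
    finally show ?thesis
      using \<epsilon> j hardy2_tail_nonneg[OF k, of N] by (subst (asm) ennreal_le_iff) auto
  qed
  \<comment> \<open>First N goes to infinity at fixed \<epsilon>, because the factor 1 +
    1/\<epsilon> of the tail blows up as \<epsilon> tends to 0.\<close>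
  have total: "2 * pi * (\<Sum>n. ?a n) \<le> (1 + \<epsilon>) * j" if "0 < \<epsilon>" for \<epsilon>
  proof (rule tendsto_le[OF _ _ _ always_eventually])
    show "(\<lambda>N. (1 + \<epsilon>) * j + (1 + 1 / \<epsilon>) * (2 * pi * hardy2_tail N k)) \<longlonglongrightarrow> (1 + \<epsilon>) * j"
      by (rule tendsto_eq_intros hardy2_tail_tendsto k refl)+ simp
    show "(\<lambda>N. 2 * pi * (\<Sum>n<N. ?a n)) \<longlonglongrightarrow> 2 * pi * (\<Sum>n. ?a n)"
      by (intro tendsto_intros summable_LIMSEQ hardy2_taylor_coeff k)
  qed (use partial that in auto)
  have total_le: "2 * pi * (\<Sum>n. ?a n) \<le> j"
  proof (rule tendsto_lowerbound)
    show "((\<lambda>\<epsilon>. (1 + \<epsilon>) * j) \<longlongrightarrow> j) (at_right 0)"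
      by (auto intro!: tendsto_eq_intros)
    show "\<forall>\<^sub>F \<epsilon> in at_right 0. 2 * pi * (\<Sum>n. ?a n) \<le> (1 + \<epsilon>) * j"
      using total by (auto intro: eventually_mono[OF eventually_at_right_less])
  qed simp
  have "circle_mean_square k r \<le> (\<Sum>n. ?a n)"
  proof -
    have S: "(\<lambda>n. ?a n * r ^ (2 * n)) sums circle_mean_square k r"
      by (intro circle_mean_square_sums taylor_coeff_sums hol r)
    have "?a n * r ^ (2 * n) \<le> ?a n" for n
      using r by (intro mult_left_le power_le_one) auto
    then show ?thesis
      unfolding sums_unique[OF S]
      by (rule suminf_le[OF _ sums_summable[OF S] hardy2_taylor_coeff(1)[OF k]])
  qed
  then have "2 * pi * circle_mean_square k r \<le> 2 * pi * (\<Sum>n. ?a n)"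
    by (intro mult_left_mono) auto
  also have "\<dots> \<le> j" by (rule total_le)
  finally show ?thesis unfolding j(1) by (rule ennreal_leI)
qed

section \<open>Subordination\<close>

text \<open>The Poisson kernel at an arbitrary point w of the disc, written so as to match
  \<open>poisson_formula\<close>; its denominator equals the squared distance from
  \<open>cis t\<close> to w.\<close>

definition poisson_at :: "complex \<Rightarrow> real \<Rightarrow> real" where
  "poisson_at w t = (1 - (cmod w)\<^sup>2) / (cmod (1 - cnj w * cis t))\<^sup>2"

lemma one_minus_cnj_cis_norm_ge: "1 - cmod w \<le> cmod (1 - cnj w * cis t)"
  using norm_triangle_ineq2[of 1 "cnj w * cis t"] by (simp add: norm_mult)

lemma poisson_at_nonneg: "w \<in> unit_disc \<Longrightarrow> 0 \<le> poisson_at w t"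
  by (auto simp: poisson_at_def abs_square_le_1 intro!: divide_nonneg_nonneg)

lemma poisson_at_le:
  assumes "w \<in> unit_disc"
  shows "poisson_at w t \<le> (1 + cmod w) / (1 - cmod w)"
proof -
  have w: "cmod w < 1" using assms by simp
  have sq: "(1 - cmod w)\<^sup>2 \<le> (cmod (1 - cnj w * cis t))\<^sup>2"
    using one_minus_cnj_cis_norm_ge w by (intro power_mono) auto
  have pos: "0 < (1 - cmod w)\<^sup>2" using w by simp
  have "poisson_at w t \<le> (1 - (cmod w)\<^sup>2) / (1 - cmod w)\<^sup>2"
    unfolding poisson_at_def using w
    by (intro divide_left_mono sq mult_pos_pos pos less_le_trans[OF pos sq]) (simp add: abs_square_le_1)
  also have "\<dots> = (1 + cmod w) / (1 - cmod w)"
  proof -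
    have "1 - (cmod w)\<^sup>2 = (1 + cmod w) * (1 - cmod w)"
      by (simp add: power2_eq_square algebra_simps)
    then show ?thesis using w by (simp add: power2_eq_square)
  qed
  finally show ?thesis .
qed

text \<open>Being the real part of a holomorphic function of w, the kernel stays harmonic when w is
  replaced by a holomorphic function of another variable; subordination rests on this.\<close>

lemma poisson_at_eq_Re:
  assumes "w \<in> unit_disc"
  shows "poisson_at w t = Re ((cis t + w) / (cis t - w))"
proof -
  have "cmod (1 - cnj w * cis t) = cmod (cis t - w)"
  proof -
    have "cnj (1 - cnj w * cis t) = (cis t - w) / cis t"
      by (simp add: field_simps cis_cnj cis_mult)
    then show ?thesis by (metis complex_mod_cnj div_by_1 norm_cis norm_divide)
  qed
  moreover have "Re ((cis t + w) / (cis t - w)) = (1 - (cmod w)\<^sup>2) / (cmod (cis t - w))\<^sup>2"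
  proof -
    have "(cis t + w) / (cis t - w) = (cis t + w) * cnj (cis t - w) / of_real ((cmod (cis t - w))\<^sup>2)"
      by (subst complex_norm_square, rule nonzero_mult_divide_mult_cancel_right[symmetric]) (use assms in auto)
    moreover have "Re ((cis t + w) * cnj (cis t - w)) = 1 - (cmod w)\<^sup>2"
    proof -
      have "Re ((cis t + w) * cnj (cis t - w)) = (sin t)\<^sup>2 + (cos t)\<^sup>2 - (cmod w)\<^sup>2"
        by (simp add: cmod_power2) (simp add: power2_eq_square algebra_simps)
      then show ?thesis by simp
    qed
    ultimately show ?thesis by (simp only: Re_divide_of_real)
  qed
  ultimately show ?thesis by (simp add: poisson_at_def)
qed

lemma continuous_on_poisson_at [continuous_intros]:
  fixes f :: "'a :: topological_space \<Rightarrow> complex"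
  assumes "continuous_on S f" "continuous_on S g" "\<And>x. x \<in> S \<Longrightarrow> f x \<in> unit_disc"
  shows "continuous_on S (\<lambda>x. poisson_at (f x) (g x))"
proof -
  have "cmod (1 - cnj (f x) * cis (g x)) \<noteq> 0" if "x \<in> S" for x
    using one_minus_cnj_cis_norm_ge[of "f x" "g x"] assms(3)[OF that] by auto
  then show ?thesis
    unfolding poisson_at_def using assms(1,2) by (intro continuous_intros) auto
qed

lemma norm_squared_le_poisson:
  fixes p :: "complex \<Rightarrow> complex"
  assumes p: "p holomorphic_on cball 0 1" and w: "w \<in> unit_disc"
  shows "2 * pi * (cmod (p w))\<^sup>2 \<le> integral {0..2 * pi} (\<lambda>t. (cmod (p (cis t)))\<^sup>2 * poisson_at w t)"
proof -
  have cp: "continuous_on (cball 0 1) p" using p by (rule holomorphic_on_imp_continuous_on)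
  have "((\<lambda>t. (p (cis t))\<^sup>2 * of_real (poisson_at w t)) has_integral 2 * pi * (p w)\<^sup>2) {0..2 * pi}"
    unfolding poisson_at_def by (intro poisson_formula[where f = "\<lambda>z. (p z)\<^sup>2"] holomorphic_intros p w)
  moreover have "((\<lambda>t. (cmod (p (cis t)))\<^sup>2 * poisson_at w t) has_integral
      integral {0..2 * pi} (\<lambda>t. (cmod (p (cis t)))\<^sup>2 * poisson_at w t)) {0..2 * pi}"
    using w by (intro integrable_integral integrable_continuous_interval continuous_intros
      continuous_on_compose2[OF cp]) auto
  ultimately have "cmod (2 * pi * (p w)\<^sup>2) \<le> integral {0..2 * pi} (\<lambda>t. (cmod (p (cis t)))\<^sup>2 * poisson_at w t)"
    by (rule has_integral_norm_bound_integral_component[where k = "1 :: real", simplified])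
       (use poisson_at_nonneg[OF w] in \<open>simp add: norm_mult norm_power\<close>)
  then show ?thesis by (simp add: norm_mult norm_power)
qed

text \<open>The Poisson bound for dilates, with the kernel replaced by its upper bound, followed by
  letting the dilation tend to the identity. The factor is that upper bound, not the sharp constant;
  it suffices that it is bounded on smaller discs.\<close>

lemma hardy2_point_evaluation:
  assumes f: "f holomorphic_on unit_disc"
    and B: "\<And>r. 0 \<le> r \<Longrightarrow> r < 1 \<Longrightarrow> circle_mean_square f r \<le> B" and w: "w \<in> unit_disc"
  shows "(cmod (f w))\<^sup>2 \<le> (1 + cmod w) / (1 - cmod w) * B"
proof -
  have cf: "continuous_on unit_disc f" using f by (rule holomorphic_on_imp_continuous_on)
  have bound: "(cmod (f (of_real (boundary_radius n) * w)))\<^sup>2 \<le> (1 + cmod w) / (1 - cmod w) * B" for n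
  proof -
    define \<rho> where "\<rho> = boundary_radius n"
    have \<rho>: "0 < \<rho>" "0 \<le> \<rho>" "\<rho> < 1" unfolding \<rho>_def by (rule boundary_radius)+
    define p where "p z = f (of_real \<rho> * z)" for z
    have "cmod (of_real \<rho> * z) < 1" if "cmod z \<le> 1" for z
    proof -
      have "\<rho> * cmod z \<le> \<rho> * 1" using \<rho>(2) that by (intro mult_left_mono)
      then have "\<rho> * cmod z < 1" using \<rho>(3) by linarith
      then show ?thesis using \<rho>(1) by (simp only: norm_mult norm_of_real abs_of_pos)
    qed
    then have p: "p holomorphic_on cball 0 1"
      unfolding p_def
      by (intro holomorphic_on_compose_gen[OF _ f, unfolded o_def] holomorphic_intros) auto
    have cp: "continuous_on S (\<lambda>t. p (cis t))" for S
      unfolding p_def by (intro continuous_on_circle_holomorphic f \<rho>)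
    have "2 * pi * (cmod (p w))\<^sup>2 \<le> integral {0..2 * pi} (\<lambda>t. (cmod (p (cis t)))\<^sup>2 * poisson_at w t)"
      by (rule norm_squared_le_poisson[OF p w])
    also have "\<dots> \<le> integral {0..2 * pi} (\<lambda>t. (cmod (p (cis t)))\<^sup>2 * ((1 + cmod w) / (1 - cmod w)))"
      using w by (intro integral_le integrable_continuous_interval continuous_intros cp
        mult_left_mono poisson_at_le) auto
    also have "\<dots> = 2 * pi * circle_mean_square f \<rho> * ((1 + cmod w) / (1 - cmod w))"
      unfolding p_def using \<rho>
      by (subst circle_mean_square_eq_integral) (auto intro!: continuous_on_subset[OF cf])
    also have "\<dots> = 2 * pi * ((1 + cmod w) / (1 - cmod w) * circle_mean_square f \<rho>)" by simp
    finally have "(cmod (p w))\<^sup>2 \<le> (1 + cmod w) / (1 - cmod w) * circle_mean_square f \<rho>"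
      by (rule mult_left_le_imp_le) simp
    also have "\<dots> \<le> (1 + cmod w) / (1 - cmod w) * B"
      using w by (intro mult_left_mono B \<rho>) auto
    finally show ?thesis by (simp add: p_def \<rho>_def)
  qed
  show ?thesis
  proof (rule tendsto_upperbound)
    have "boundary_radius \<longlonglongrightarrow> 1"
      using boundary_radius_at_left by (simp add: filterlim_at)
    then have "(\<lambda>n. of_real (boundary_radius n) * w) \<longlonglongrightarrow> of_real 1 * w"
      by (intro tendsto_intros)
    then have lim: "(\<lambda>n. of_real (boundary_radius n) * w) \<longlonglongrightarrow> w" by simp
    have "isCont f w" using cf w by (simp add: continuous_on_eq_continuous_at)
    from isCont_tendsto_compose[OF this lim] have "(\<lambda>n. f (of_real (boundary_radius n) * w)) \<longlonglongrightarrow> f w"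
      .
    then show "(\<lambda>n. (cmod (f (of_real (boundary_radius n) * w)))\<^sup>2) \<longlonglongrightarrow> (cmod (f w))\<^sup>2"
      by (intro tendsto_intros)
  qed (use bound in auto)
qed

text \<open>Littlewood's subordination principle: dominate \<open>\<bar>p\<bar>\<^sup>2\<close> by its Poisson integral, whose
  composition with \<open>\<phi>\<close> is harmonic and can be averaged exactly.\<close>

lemma littlewood_subordination:
  assumes \<phi>: "\<phi> holomorphic_on unit_disc" "\<phi> ` unit_disc \<subseteq> unit_disc"
    and p: "p holomorphic_on cball 0 1" and r: "0 \<le> r" "r < 1"
  shows "circle_mean_square (\<lambda>z. p (\<phi> z)) r
    \<le> (1 + cmod (\<phi> 0)) / (1 - cmod (\<phi> 0)) * circle_mean_square p 1"
proof -
  define \<psi> where "\<psi> \<theta> = \<phi> (of_real r * cis \<theta>)" for \<theta>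
  define K where "K = (1 + cmod (\<phi> 0)) / (1 - cmod (\<phi> 0))"
  have \<psi>: "\<psi> \<theta> \<in> unit_disc" for \<theta>
    using \<phi>(2) r unfolding \<psi>_def by (auto simp: norm_mult image_subset_iff)
  have \<phi>0: "\<phi> 0 \<in> unit_disc" using \<phi>(2) by (simp add: image_subset_iff)
  have c\<psi>: "continuous_on S \<psi>" for S
    unfolding \<psi>_def by (intro continuous_on_circle_holomorphic \<phi> r)
  have cp: "continuous_on (cball 0 1) p" using p by (rule holomorphic_on_imp_continuous_on)
  have cpc: "continuous_on S (\<lambda>t. p (cis t))" for S
    by (intro continuous_on_compose2[OF cp] continuous_intros) auto
  have cp\<psi>: "continuous_on S (\<lambda>\<theta>. p (\<psi> \<theta>))" for S
    by (intro continuous_on_compose2[OF cp] c\<psi>) (use \<psi> in \<open>auto simp: less_imp_le\<close>)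
  have mean: "integral {0..2 * pi} (\<lambda>\<theta>. poisson_at (\<psi> \<theta>) t) = 2 * pi * poisson_at (\<phi> 0) t" for t
  proof -
    \<comment> \<open>The real part of \<open>G\<close> on the unit circle is the kernel at
      \<open>\<psi> \<theta>\<close>. The Poisson formula at 0 is the mean value property, so the
      average over \<theta> is the kernel at \<open>\<phi> 0\<close>.\<close>
    define G where "G z = (cis t + \<phi> (of_real r * z)) / (cis t - \<phi> (of_real r * z))" for z
    have in_disc: "of_real r * z \<in> unit_disc" if "z \<in> cball 0 1" for z
    proof -
      have "r * cmod z \<le> r * 1" using r(1) that by (intro mult_left_mono) auto
      then have "r * cmod z < 1" using r(2) by linarith
      then show ?thesis using r(1) by (simp add: norm_mult)
    qed
    have hol: "(\<lambda>z. \<phi> (of_real r * z)) holomorphic_on cball 0 1"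
      by (intro holomorphic_on_compose_gen[OF _ \<phi>(1), unfolded o_def] holomorphic_intros)
         (use in_disc in blast)
    have ne: "cis t - \<phi> (of_real r * z) \<noteq> 0" if "z \<in> cball 0 1" for z
    proof
      assume "cis t - \<phi> (of_real r * z) = 0"
      then have "cmod (\<phi> (of_real r * z)) = 1" by (metis eq_iff_diff_eq_0 norm_cis)
      moreover have "\<phi> (of_real r * z) \<in> unit_disc" using in_disc[OF that] \<phi>(2) by blast
      ultimately show False by simp
    qed
    have "G holomorphic_on cball 0 1"
      unfolding G_def by (intro holomorphic_on_divide holomorphic_on_add holomorphic_on_diff hol holomorphic_intros ne)
    from poisson_formula[OF this, of 0] have "((\<lambda>\<theta>. G (cis \<theta>)) has_integral 2 * pi * G 0) {0..2 * pi}"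
      by simp
    from has_integral_Re[OF this]
    have "((\<lambda>\<theta>. poisson_at (\<psi> \<theta>) t) has_integral 2 * pi * poisson_at (\<phi> 0) t) {0..2 * pi}"
      by (simp add: poisson_at_eq_Re[OF \<psi>] poisson_at_eq_Re[OF \<phi>0]) (simp add: G_def \<psi>_def)
    then show ?thesis by (rule integral_unique)
  qed
  have "2 * pi * integral {0..2 * pi} (\<lambda>\<theta>. (cmod (p (\<psi> \<theta>)))\<^sup>2)
      = integral {0..2 * pi} (\<lambda>\<theta>. 2 * pi * (cmod (p (\<psi> \<theta>)))\<^sup>2)"
    by simp
  also have "\<dots> \<le> integral {0..2 * pi} (\<lambda>\<theta>. integral {0..2 * pi} (\<lambda>t. (cmod (p (cis t)))\<^sup>2 * poisson_at (\<psi> \<theta>) t))"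
  proof (rule integral_le)
    have "continuous_on ({0..2 * pi} \<times> {0..2 * pi}) (\<lambda>x. (cmod (p (cis (snd x))))\<^sup>2 * poisson_at (\<psi> (fst x)) (snd x))"
      using \<psi> by (intro continuous_intros continuous_on_compose2[OF cpc[of UNIV]] continuous_on_compose2[OF c\<psi>[of UNIV]]) auto
    then have "continuous_on {0..2 * pi} (\<lambda>\<theta>. integral (cbox 0 (2 * pi)) (\<lambda>t. (cmod (p (cis t)))\<^sup>2 * poisson_at (\<psi> \<theta>) t))"
      by (intro integral_continuous_on_param) (simp add: case_prod_unfold)
    then show "(\<lambda>\<theta>. integral {0..2 * pi} (\<lambda>t. (cmod (p (cis t)))\<^sup>2 * poisson_at (\<psi> \<theta>) t)) integrable_on {0..2 * pi}"
      by (intro integrable_continuous_interval) simp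
  qed (use norm_squared_le_poisson[OF p \<psi>] in \<open>auto intro!: integrable_continuous_interval continuous_intros cp\<psi>\<close>)
  \<comment> \<open>After the exchange the inner average is known exactly from \<open>mean\<close>;
    the only trace of \<phi> left is \<open>\<phi> 0\<close>, whose kernel is at most
    \<open>K\<close>.\<close>
  also have "\<dots> = integral {0..2 * pi} (\<lambda>t. integral {0..2 * pi} (\<lambda>\<theta>. (cmod (p (cis t)))\<^sup>2 * poisson_at (\<psi> \<theta>) t))"
  proof -
    have "continuous_on (cbox (0, 0) (2 * pi, 2 * pi)) (\<lambda>(\<theta>, t). (cmod (p (cis t)))\<^sup>2 * poisson_at (\<psi> \<theta>) t)"
      unfolding case_prod_unfold
      using \<psi> by (intro continuous_intros continuous_on_compose2[OF cpc[of UNIV]] continuous_on_compose2[OF c\<psi>[of UNIV]]) auto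
    from integral_swap_continuous[OF this] show ?thesis by simp
  qed
  also have "\<dots> = integral {0..2 * pi} (\<lambda>t. (cmod (p (cis t)))\<^sup>2 * (2 * pi * poisson_at (\<phi> 0) t))"
    by (simp add: mean)
  also have "\<dots> \<le> integral {0..2 * pi} (\<lambda>t. (cmod (p (cis t)))\<^sup>2 * (2 * pi * K))"
    unfolding K_def using \<phi>0
    by (intro integral_le integrable_continuous_interval continuous_intros cpc
      mult_left_mono poisson_at_le) auto
  also have "\<dots> = 2 * pi * (K * integral {0..2 * pi} (\<lambda>t. (cmod (p (cis t)))\<^sup>2))"
    by simp
  finally have "integral {0..2 * pi} (\<lambda>\<theta>. (cmod (p (\<psi> \<theta>)))\<^sup>2) \<le> K * integral {0..2 * pi} (\<lambda>t. (cmod (p (cis t)))\<^sup>2)"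
    by simp
  also have "integral {0..2 * pi} (\<lambda>t. (cmod (p (cis t)))\<^sup>2) = 2 * pi * circle_mean_square p 1"
    by (subst circle_mean_square_eq_integral) (auto intro: continuous_on_subset[OF cp])
  also have "integral {0..2 * pi} (\<lambda>\<theta>. (cmod (p (\<psi> \<theta>)))\<^sup>2) = 2 * pi * circle_mean_square (\<lambda>z. p (\<phi> z)) r"
  proof -
    have "continuous_on (sphere 0 \<bar>r\<bar>) (\<lambda>z. p (\<phi> z))"
    proof (intro continuous_on_compose2[OF cp] continuous_on_subset[OF holomorphic_on_imp_continuous_on[OF \<phi>(1)]])
      show "\<phi> ` sphere 0 \<bar>r\<bar> \<subseteq> cball 0 1"
        using \<phi>(2) r by (force simp: image_subset_iff)
    qed (use r in auto)
    from circle_mean_square_eq_integral[OF this] show ?thesis by (simp add: \<psi>_def)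
  qed
  finally have "2 * pi * circle_mean_square (\<lambda>z. p (\<phi> z)) r \<le> 2 * pi * (K * circle_mean_square p 1)"
    by (simp add: mult_ac)
  then show ?thesis unfolding K_def by (rule mult_left_le_imp_le) simp
qed

section \<open>Weighted composition operators\<close>

lemma circle_mean_square_le_mult:
  assumes f: "f holomorphic_on unit_disc" and g: "g holomorphic_on unit_disc"
    and r: "0 \<le> r" "r < 1" and le: "\<And>z. z \<in> unit_disc \<Longrightarrow> (cmod (f z))\<^sup>2 \<le> C * (cmod (g z))\<^sup>2"
  shows "circle_mean_square f r \<le> C * circle_mean_square g r"
proof -
  have cont: "continuous_on (sphere 0 \<bar>r\<bar>) u" if "u holomorphic_on unit_disc" for u :: "complex \<Rightarrow> complex"
    using r by (intro continuous_on_subset[OF holomorphic_on_imp_continuous_on[OF that]]) auto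
  have "2 * pi * circle_mean_square f r \<le> integral {0..2 * pi} (\<lambda>\<theta>. C * (cmod (g (of_real r * cis \<theta>)))\<^sup>2)"
    unfolding circle_mean_square_eq_integral[OF cont[OF f]] using r
    by (intro integral_le integrable_continuous_interval continuous_intros
        continuous_on_circle_holomorphic f g le) (auto simp: norm_mult)
  also have "\<dots> = 2 * pi * (C * circle_mean_square g r)"
    using circle_mean_square_eq_integral[OF cont[OF g]] by (simp add: mult_ac)
  finally show ?thesis by simp
qed

lemma circle_mean_square_diff_le:
  assumes f: "f holomorphic_on unit_disc" and g: "g holomorphic_on unit_disc" and r: "0 \<le> r" "r < 1"
  shows "circle_mean_square (\<lambda>z. f z - g z) r \<le> 2 * circle_mean_square f r + 2 * circle_mean_square g r"
proof -
  have cont: "continuous_on (sphere 0 \<bar>r\<bar>) u" if "u holomorphic_on unit_disc" for u :: "complex \<Rightarrow> complex"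
    using r by (intro continuous_on_subset[OF holomorphic_on_imp_continuous_on[OF that]]) auto
  have fg: "(\<lambda>z. f z - g z) holomorphic_on unit_disc" by (intro holomorphic_intros f g)
  have le: "(cmod (x - y))\<^sup>2 \<le> 2 * (cmod x)\<^sup>2 + 2 * (cmod y)\<^sup>2" for x y
  proof -
    have "(cmod (x - y))\<^sup>2 \<le> (cmod x + cmod y)\<^sup>2" by (intro power_mono norm_triangle_ineq4) auto
    also have "\<dots> \<le> 2 * (cmod x)\<^sup>2 + 2 * (cmod y)\<^sup>2"
      using zero_le_power2[of "cmod x - cmod y"] by (simp add: power2_sum power2_diff)
    finally show ?thesis .
  qed
  have int: "(\<lambda>\<theta>. 2 * (cmod (u (of_real r * cis \<theta>)))\<^sup>2) integrable_on {0..2 * pi}"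
    if "u holomorphic_on unit_disc" for u
    using that r by (intro integrable_continuous_interval continuous_intros continuous_on_circle_holomorphic)
  have "2 * pi * circle_mean_square (\<lambda>z. f z - g z) r
      \<le> integral {0..2 * pi} (\<lambda>\<theta>. 2 * (cmod (f (of_real r * cis \<theta>)))\<^sup>2 + 2 * (cmod (g (of_real r * cis \<theta>)))\<^sup>2)"
    unfolding circle_mean_square_eq_integral[OF cont[OF fg]] using r
    by (intro integral_le integrable_continuous_interval continuous_intros
        continuous_on_circle_holomorphic f g le)
  also have "\<dots> = 2 * pi * (2 * circle_mean_square f r + 2 * circle_mean_square g r)"
    using circle_mean_square_eq_integral[OF cont[OF f]] circle_mean_square_eq_integral[OF cont[OF g]]
    by (subst Henstock_Kurzweil_Integration.integral_add[OF int[OF f] int[OF g]]) (simp add: distrib_left)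
  finally show ?thesis by (rule mult_left_le_imp_le) simp
qed

text \<open>Fatou's lemma on one circle. It serves twice: to pass from Taylor polynomials to f under
  the operator, and to keep a locally uniform limit inside the space. The bounds may vary with n,
  since the polynomial estimates do.\<close>

lemma circle_mean_square_pointwise_limit:
  assumes F: "\<And>n. F n holomorphic_on unit_disc" and g: "g holomorphic_on unit_disc"
    and lim: "\<And>z. z \<in> unit_disc \<Longrightarrow> (\<lambda>n. F n z) \<longlonglongrightarrow> g z"
    and r: "0 \<le> r" "r < 1"
    and le: "\<And>n. circle_mean_square (F n) r \<le> b n" and b: "b \<longlonglongrightarrow> B"
  shows "circle_mean_square g r \<le> B"
proof -
  define u where "u n \<theta> = ennreal ((cmod (F n (of_real r * cis \<theta>)))\<^sup>2)" for n \<theta>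
  have [measurable]: "(\<lambda>\<theta>. F n (of_real r * cis \<theta>)) \<in> borel_measurable angle_measure" for n
    by (intro continuous_on_imp_angle_measurable continuous_on_circle_holomorphic F r)
  have "liminf (\<lambda>n. u n \<theta>) = ennreal ((cmod (g (of_real r * cis \<theta>)))\<^sup>2)" for \<theta>
    unfolding u_def using r
    by (intro lim_imp_Liminf tendsto_intros lim) (auto simp: norm_mult)
  then have "ennreal (2 * pi * circle_mean_square g r) = (\<integral>\<^sup>+\<theta>. liminf (\<lambda>n. u n \<theta>) \<partial>angle_measure)"
    using nn_integral_circle_mean_square_holomorphic[OF g r] by simp
  also have "\<dots> \<le> liminf (\<lambda>n. \<integral>\<^sup>+\<theta>. u n \<theta> \<partial>angle_measure)"
    unfolding u_def by (intro nn_integral_liminf) measurable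
  also have "\<dots> \<le> liminf (\<lambda>n. ennreal (2 * pi * b n))"
    unfolding u_def nn_integral_circle_mean_square_holomorphic[OF F r]
    by (intro Liminf_mono always_eventually allI ennreal_leI mult_left_mono le) auto
  also have "\<dots> = ennreal (2 * pi * B)"
    by (intro lim_imp_Liminf tendsto_intros b) auto
  finally have "ennreal (2 * pi * circle_mean_square g r) \<le> ennreal (2 * pi * B)" .
  moreover have "0 \<le> B"
    using b by (rule LIMSEQ_le_const) (metis circle_mean_square_nonneg le order_trans)
  ultimately show ?thesis by (subst (asm) ennreal_le_iff) auto
qed

lemma hardy2_mult_bounded:
  assumes h: "h \<in> hardy2" and b: "b holomorphic_on unit_disc" and M: "\<And>z. z \<in> unit_disc \<Longrightarrow> cmod (b z) \<le> M"
  shows "(\<lambda>z. h z * b z) \<in> hardy2"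
proof -
  have hol: "h holomorphic_on unit_disc" using h by (simp add: hardy2_def)
  show ?thesis
  proof (rule hardy2I(1))
    show "(\<lambda>z. h z * b z) holomorphic_on unit_disc" by (intro holomorphic_intros hol b)
    fix r :: real assume r: "0 \<le> r" "r < 1"
    have "circle_mean_square (\<lambda>z. h z * b z) r \<le> M\<^sup>2 * circle_mean_square h r"
    proof (rule circle_mean_square_le_mult[OF _ hol r])
      show "(\<lambda>z. h z * b z) holomorphic_on unit_disc" by (intro holomorphic_intros hol b)
      fix z assume "z \<in> unit_disc"
      then show "(cmod (h z * b z))\<^sup>2 \<le> M\<^sup>2 * (cmod (h z))\<^sup>2"
        using M by (auto simp: norm_mult power_mult_distrib mult.commute intro!: mult_right_mono power_mono)
    qed
    also have "\<dots> \<le> M\<^sup>2 * (hardy2_norm h)\<^sup>2"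
      by (intro mult_left_mono hardy2_circle_mean_square_le h r) auto
    finally show "circle_mean_square (\<lambda>z. h z * b z) r \<le> M\<^sup>2 * (hardy2_norm h)\<^sup>2" .
  qed
qed

lemma one_in_hardy2: "(\<lambda>_. 1) \<in> hardy2"
  by (rule hardy2I(1)[of _ 1]) (auto simp: circle_mean_square_def set_lebesgue_integral_def)

lemma bounded_holomorphic_in_hardy2:
  assumes "b holomorphic_on unit_disc" "\<And>z. z \<in> unit_disc \<Longrightarrow> cmod (b z) \<le> M"
  shows "b \<in> hardy2"
  using hardy2_mult_bounded[OF one_in_hardy2 assms] by simp

lemma hardy2_norm_nonneg: "f \<in> hardy2 \<Longrightarrow> 0 \<le> hardy2_norm f"
  using hardy2_circle_mean_square_le[of f 0] circle_mean_square_nonneg[of f 0] hardy2_norm_squared[of f]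
  unfolding hardy2_norm_def by (metis order_trans real_sqrt_ge_zero less_numeral_extra(1) order_refl)

lemma taylor_remainder_bound:
  assumes f: "f \<in> hardy2" and w: "w \<in> unit_disc"
  shows "(cmod (f w - taylor_poly N f w))\<^sup>2 \<le> (1 + cmod w) / (1 - cmod w) * hardy2_tail N f"
proof -
  have "(\<lambda>z. f z - taylor_poly N f z) holomorphic_on unit_disc"
    using f by (intro holomorphic_intros) (simp add: hardy2_def)
  from hardy2_point_evaluation[OF this circle_mean_square_taylor_remainder[OF f] w] show ?thesis .
qed

lemma AE_circle_measure_imp_angle:
  assumes "AE z in circle_measure. P z"
  shows "AE \<theta> in angle_measure. P (cis \<theta>)"
proof -
  have "continuous_on UNIV cis" by (intro continuous_intros)
  then have "cis \<in> borel_measurable borel" by (rule borel_measurable_continuous_onI)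
  then have "cis \<in> borel_measurable (uniform_measure lborel {0..2 * pi})"
    by (subst measurable_cong_sets[of _ borel _ borel]) auto
  from AE_distrD[OF this assms[unfolded circle_measure_def]]
  have "AE \<theta> in uniform_measure lborel {0..2 * pi}. P (cis \<theta>)" .
  then have "AE \<theta> in lborel. \<theta> \<in> {0..2 * pi} \<longrightarrow> P (cis \<theta>)"
    by (subst (asm) AE_uniform_measure) auto
  then show ?thesis by (subst AE_restrict_space_iff) auto
qed

section \<open>The basic estimate and boundedness of the operator\<close>

locale weighted_composition =
  fixes \<phi> h :: "complex \<Rightarrow> complex"
  assumes \<phi>_holomorphic: "\<phi> holomorphic_on unit_disc"
    and \<phi>_disc: "\<phi> ` unit_disc \<subseteq> unit_disc"
    and h_hardy2: "h \<in> hardy2"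
begin

text \<open>Littlewood's bound for the squared norm of composition with \<phi>.\<close>

definition norm_const :: real where
  "norm_const = (1 + cmod (\<phi> 0)) / (1 - cmod (\<phi> 0))"

lemma \<phi>_in_disc: "z \<in> unit_disc \<Longrightarrow> \<phi> z \<in> unit_disc"
  using \<phi>_disc by blast

lemma norm_const_nonneg: "0 \<le> norm_const"
  using \<phi>_in_disc[of 0] by (auto simp: norm_const_def)

lemma h_holomorphic: "h holomorphic_on unit_disc"
  using h_hardy2 by (simp add: hardy2_def)

lemma compose_\<phi>_holomorphic:
  assumes "f holomorphic_on unit_disc"
  shows "(\<lambda>z. f (\<phi> z)) holomorphic_on unit_disc"
  by (rule holomorphic_on_compose_gen[OF \<phi>_holomorphic assms \<phi>_disc, unfolded o_def])

lemma weighted_comp_holomorphic: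
  assumes "f holomorphic_on unit_disc"
  shows "weighted_comp h \<phi> f holomorphic_on unit_disc"
  unfolding weighted_comp_def by (intro holomorphic_on_mult h_holomorphic compose_\<phi>_holomorphic assms)

definition weight_bound :: "real \<Rightarrow> real \<Rightarrow> bool" where
  "weight_bound \<delta> c \<longleftrightarrow> (AE z in circle_measure.
     z \<in> near_boundary_set \<phi> \<delta> \<longrightarrow> cmod (radial_limit h z) \<le> c)"

text \<open>For \<open>f\<close> continuous up to the boundary the boundary values of \<open>h \<sqdot> f \<circ> \<phi>\<close> are explicit,
  and the circle splits into the part where \<open>h\<close> is small and the part where \<open>f \<circ> \<phi>\<close> is small.\<close>

lemma weighted_comp_mean_square_le_entire:
  assumes wb: "weight_bound \<delta> c" and c: "0 \<le> c"
    and p: "p holomorphic_on UNIV" and m: "\<And>w. cmod w \<le> 1 - \<delta> \<Longrightarrow> cmod (p w) \<le> m" and "0 \<le> m"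
    and r: "0 \<le> r" "r < 1"
  shows "circle_mean_square (weighted_comp h \<phi> p) r
    \<le> c\<^sup>2 * (norm_const * circle_mean_square p 1) + m\<^sup>2 * (hardy2_norm h)\<^sup>2"
proof -
  define k where "k z = h z * p (\<phi> z)" for z
  define P where "P z = p (\<phi> z)" for z
  have cp: "continuous_on UNIV p" using p by (rule holomorphic_on_imp_continuous_on)
  have P_hol: "P holomorphic_on unit_disc"
    unfolding P_def by (intro compose_\<phi>_holomorphic holomorphic_on_subset[OF p]) auto
  have "compact (p ` cball 0 1)"
    by (intro compact_continuous_image continuous_on_subset[OF cp]) auto
  then obtain M where M: "\<And>w. w \<in> cball 0 1 \<Longrightarrow> cmod (p w) \<le> M"
    by (meson compact_imp_bounded bounded_iff imageI)
  have PM: "cmod (P z) \<le> M" if "z \<in> unit_disc" for z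
    unfolding P_def by (intro M) (use \<phi>_in_disc[OF that] in auto)
  have P: "P \<in> hardy2" by (rule bounded_holomorphic_in_hardy2[OF P_hol PM])
  have \<phi>: "\<phi> \<in> hardy2"
    by (rule bounded_holomorphic_in_hardy2[OF \<phi>_holomorphic, of 1]) (use \<phi>_in_disc in force)
  \<comment> \<open>A product of two \<open>hardy2\<close> functions need not belong to
    \<open>hardy2\<close>; here the second factor is bounded because \<open>p\<close> is bounded on
    the closed disc. This makes \<open>circle_mean_square_le_boundary\<close> applicable to
    \<open>k\<close>.\<close>
  have k: "k \<in> hardy2"
    unfolding k_def P_def[symmetric] by (rule hardy2_mult_bounded[OF h_hardy2 P_hol PM])
  have [measurable]: "boundary_value h \<in> borel_measurable angle_measure" "boundary_value P \<in> borel_measurable angle_measure"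
    by (intro boundary_value_measurable h_holomorphic P_hol)+
  have "AE \<theta> in angle_measure. 1 - \<delta> \<le> cmod (radial_limit \<phi> (cis \<theta>)) \<longrightarrow> cmod (radial_limit h (cis \<theta>)) \<le> c"
    using AE_circle_measure_imp_angle[OF wb[unfolded weight_bound_def]] by (simp add: near_boundary_set_def)
  then have "AE \<theta> in angle_measure. ennreal ((cmod (boundary_value k \<theta>))\<^sup>2)
      \<le> ennreal (c\<^sup>2) * ennreal ((cmod (boundary_value P \<theta>))\<^sup>2) + ennreal (m\<^sup>2) * ennreal ((cmod (boundary_value h \<theta>))\<^sup>2)"
    using hardy2_boundary_value[OF h_hardy2] hardy2_boundary_value[OF \<phi>]
  proof eventually_elim
    case (elim \<theta>)
    define H where "H = boundary_value h \<theta>"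
    define w where "w = boundary_value \<phi> \<theta>"
    have H: "((\<lambda>r. h (of_real r * cis \<theta>)) \<longlongrightarrow> H) (at_left 1)"
      and w: "((\<lambda>r. \<phi> (of_real r * cis \<theta>)) \<longlongrightarrow> w) (at_left 1)"
      using elim(2,3) unfolding H_def w_def .
    have pw: "((\<lambda>r. p (\<phi> (of_real r * cis \<theta>))) \<longlongrightarrow> p w) (at_left 1)"
      by (rule continuous_on_tendsto_compose[OF cp w]) auto
    have eqs: "boundary_value P \<theta> = p w" "boundary_value k \<theta> = H * p w"
      using pw tendsto_mult[OF H pw] by (auto intro!: boundary_value_eqI simp: P_def k_def)
    have "1 - \<delta> \<le> cmod w \<longrightarrow> cmod H \<le> c"
      using elim(1) radial_limit_eqI[OF H] radial_limit_eqI[OF w] by simp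
    then consider "cmod H \<le> c" | "cmod (p w) \<le> m" using m[of w] by linarith
    \<comment> \<open>The sum of the two bounds holds in either case, so the integral need not be
      split into two measurable pieces.\<close>
    then have "(cmod (H * p w))\<^sup>2 \<le> c\<^sup>2 * (cmod (p w))\<^sup>2 + m\<^sup>2 * (cmod H)\<^sup>2"
    proof cases
      case 1
      then have "(cmod H)\<^sup>2 * (cmod (p w))\<^sup>2 \<le> c\<^sup>2 * (cmod (p w))\<^sup>2"
        by (intro mult_right_mono power_mono) auto
      then show ?thesis by (simp add: norm_mult power_mult_distrib add_increasing2)
    next
      case 2
      then have "(cmod (p w))\<^sup>2 * (cmod H)\<^sup>2 \<le> m\<^sup>2 * (cmod H)\<^sup>2"
        by (intro mult_right_mono power_mono) auto
      then show ?thesis by (simp add: norm_mult power_mult_distrib add_increasing mult.commute)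
    qed
    from ennreal_leI[OF this] show ?case
      unfolding eqs H_def[symmetric] by (subst (asm) ennreal_weighted_sum) simp_all
  qed
  then have "(\<integral>\<^sup>+\<theta>. ennreal ((cmod (boundary_value k \<theta>))\<^sup>2) \<partial>angle_measure)
      \<le> (\<integral>\<^sup>+\<theta>. ennreal (c\<^sup>2) * ennreal ((cmod (boundary_value P \<theta>))\<^sup>2)
           + ennreal (m\<^sup>2) * ennreal ((cmod (boundary_value h \<theta>))\<^sup>2) \<partial>angle_measure)"
    by (rule nn_integral_mono_AE)
  also have "\<dots> = ennreal (c\<^sup>2) * (\<integral>\<^sup>+\<theta>. ennreal ((cmod (boundary_value P \<theta>))\<^sup>2) \<partial>angle_measure)
      + ennreal (m\<^sup>2) * (\<integral>\<^sup>+\<theta>. ennreal ((cmod (boundary_value h \<theta>))\<^sup>2) \<partial>angle_measure)"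
    by (subst nn_integral_add) (measurable, simp add: nn_integral_cmult)
  also have "\<dots> \<le> ennreal (c\<^sup>2) * ennreal (2 * pi * (norm_const * circle_mean_square p 1))
      + ennreal (m\<^sup>2) * ennreal (2 * pi * (hardy2_norm h)\<^sup>2)"
  proof (intro add_mono mult_left_mono)
    show "(\<integral>\<^sup>+\<theta>. ennreal ((cmod (boundary_value P \<theta>))\<^sup>2) \<partial>angle_measure)
        \<le> ennreal (2 * pi * (norm_const * circle_mean_square p 1))"
      unfolding norm_const_def
      by (intro nn_integral_boundary_value_le[OF P] littlewood_subordination[OF \<phi>_holomorphic \<phi>_disc,
            where p = p, folded P_def] holomorphic_on_subset[OF p]) auto
    show "(\<integral>\<^sup>+\<theta>. ennreal ((cmod (boundary_value h \<theta>))\<^sup>2) \<partial>angle_measure) \<le> ennreal (2 * pi * (hardy2_norm h)\<^sup>2)"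
      by (intro nn_integral_boundary_value_le[OF h_hardy2] hardy2_circle_mean_square_le h_hardy2)
  qed auto
  also have "\<dots> = ennreal (c\<^sup>2 * (2 * pi * (norm_const * circle_mean_square p 1)) + m\<^sup>2 * (2 * pi * (hardy2_norm h)\<^sup>2))"
    by (intro ennreal_weighted_sum[symmetric]) (simp_all add: norm_const_nonneg circle_mean_square_nonneg)
  finally have "ennreal (2 * pi * circle_mean_square k r)
      \<le> ennreal (c\<^sup>2 * (2 * pi * (norm_const * circle_mean_square p 1)) + m\<^sup>2 * (2 * pi * (hardy2_norm h)\<^sup>2))"
    using circle_mean_square_le_boundary[OF k r] by (rule order_trans[rotated])
  then have "2 * pi * circle_mean_square k r
      \<le> c\<^sup>2 * (2 * pi * (norm_const * circle_mean_square p 1)) + m\<^sup>2 * (2 * pi * (hardy2_norm h)\<^sup>2)"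
    by (subst (asm) ennreal_le_iff) (simp_all add: norm_const_nonneg circle_mean_square_nonneg)
  also have "\<dots> = 2 * pi * (c\<^sup>2 * (norm_const * circle_mean_square p 1) + m\<^sup>2 * (hardy2_norm h)\<^sup>2)"
    by (simp add: algebra_simps)
  finally show ?thesis
    unfolding weighted_comp_def k_def by (rule mult_left_le_imp_le) simp
qed

text \<open>Taylor polynomials satisfy the estimate with constants converging to those claimed:
  their mean squares on the circle are at most the squared norm of f, and on the smaller disc they
  approach f uniformly. At a fixed radius pointwise convergence then suffices.\<close>

lemma weighted_comp_mean_square_le:
  assumes wb: "weight_bound \<delta> c" and c: "0 \<le> c" and \<delta>: "0 < \<delta>"
    and f: "f \<in> hardy2" and m: "\<And>w. cmod w \<le> 1 - \<delta> \<Longrightarrow> cmod (f w) \<le> m" and "0 \<le> m"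
    and r: "0 \<le> r" "r < 1"
  shows "circle_mean_square (weighted_comp h \<phi> f) r
    \<le> c\<^sup>2 * (norm_const * (hardy2_norm f)\<^sup>2) + m\<^sup>2 * (hardy2_norm h)\<^sup>2"
proof (rule circle_mean_square_pointwise_limit[OF _ _ _ r])
  have f_hol: "f holomorphic_on unit_disc" using f by (simp add: hardy2_def)
  \<comment> \<open>The square root bounds the Taylor remainder on the disc of radius
    \<open>1 - \<delta>\<close>, where the point evaluation factor (1 + |w|) / (1 - |w|) is at most
    2/\<delta>.\<close>
  define \<mu> where "\<mu> N = m + sqrt (2 / \<delta> * hardy2_tail N f)" for N
  have \<mu>: "0 \<le> \<mu> N" for N
    unfolding \<mu>_def using \<delta> \<open>0 \<le> m\<close> hardy2_tail_nonneg[OF f] by simp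
  show "weighted_comp h \<phi> (taylor_poly N f) holomorphic_on unit_disc" for N
    by (intro weighted_comp_holomorphic) (rule taylor_poly_holomorphic[where g = "\<lambda>z. z", OF holomorphic_on_ident])
  show "weighted_comp h \<phi> f holomorphic_on unit_disc" by (rule weighted_comp_holomorphic[OF f_hol])
  show "(\<lambda>N. weighted_comp h \<phi> (taylor_poly N f) z) \<longlonglongrightarrow> weighted_comp h \<phi> f z" if "z \<in> unit_disc" for z
    unfolding weighted_comp_def taylor_poly_def
    using taylor_coeff_sums[OF f_hol \<phi>_in_disc[OF that]]
    by (intro tendsto_mult tendsto_const) (simp add: sums_def)
  show "circle_mean_square (weighted_comp h \<phi> (taylor_poly N f)) r
      \<le> c\<^sup>2 * (norm_const * (hardy2_norm f)\<^sup>2) + (\<mu> N)\<^sup>2 * (hardy2_norm h)\<^sup>2" for N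
  proof -
    have "circle_mean_square (weighted_comp h \<phi> (taylor_poly N f)) r
      \<le> c\<^sup>2 * (norm_const * circle_mean_square (taylor_poly N f) 1) + (\<mu> N)\<^sup>2 * (hardy2_norm h)\<^sup>2"
    proof (rule weighted_comp_mean_square_le_entire[OF wb c _ _ \<mu> r])
      show "taylor_poly N f holomorphic_on UNIV"
        by (rule taylor_poly_holomorphic[where g = "\<lambda>z. z", OF holomorphic_on_ident])
      fix w assume w: "cmod w \<le> 1 - \<delta>"
      then have w1: "w \<in> unit_disc" using \<delta> by simp
      have "(1 + cmod w) / (1 - cmod w) \<le> 2 / \<delta>"
        using w \<delta> by (intro frac_le) auto
      then have "(cmod (f w - taylor_poly N f w))\<^sup>2 \<le> 2 / \<delta> * hardy2_tail N f"
        by (rule order_trans[OF taylor_remainder_bound[OF f w1] mult_right_mono])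
           (rule hardy2_tail_nonneg[OF f])
      then have "cmod (f w - taylor_poly N f w) \<le> sqrt (2 / \<delta> * hardy2_tail N f)"
        by (rule real_le_rsqrt)
      moreover have "cmod (taylor_poly N f w) \<le> cmod (f w) + cmod (f w - taylor_poly N f w)"
        by (metis norm_minus_commute norm_triangle_sub)
      ultimately show "cmod (taylor_poly N f w) \<le> \<mu> N"
        unfolding \<mu>_def using m[OF w] by linarith
    qed
    also have "circle_mean_square (taylor_poly N f) 1 \<le> (hardy2_norm f)\<^sup>2"
      unfolding circle_mean_square_taylor_poly
      by (rule order_trans[OF sum_le_suminf hardy2_taylor_coeff(2)[OF f]])
         (auto intro: hardy2_taylor_coeff[OF f])
    finally show ?thesis using norm_const_nonneg by (simp add: mult_left_mono)
  qed
  have "\<mu> \<longlonglongrightarrow> m + sqrt (2 / \<delta> * 0)"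
    unfolding \<mu>_def by (intro tendsto_intros hardy2_tail_tendsto f)
  then have "\<mu> \<longlonglongrightarrow> m" by simp
  then show "(\<lambda>N. c\<^sup>2 * (norm_const * (hardy2_norm f)\<^sup>2) + (\<mu> N)\<^sup>2 * (hardy2_norm h)\<^sup>2)
      \<longlonglongrightarrow> c\<^sup>2 * (norm_const * (hardy2_norm f)\<^sup>2) + m\<^sup>2 * (hardy2_norm h)\<^sup>2"
    by (intro tendsto_intros)
qed

lemma weighted_comp_hardy2:
  assumes "weight_bound \<delta> c" "0 \<le> c" "0 < \<delta>" and f: "f \<in> hardy2"
  shows "weighted_comp h \<phi> f \<in> hardy2"
    and "(hardy2_norm (weighted_comp h \<phi> f))\<^sup>2 \<le> (c\<^sup>2 * norm_const + 2 / \<delta> * (hardy2_norm h)\<^sup>2) * (hardy2_norm f)\<^sup>2"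
proof -
  have f_hol: "f holomorphic_on unit_disc" using f by (simp add: hardy2_def)
  \<comment> \<open>Point evaluation supplies this supremum bound on the smaller disc; as it is
    proportional to the norm of f, both terms of the estimate become multiples of the squared
    norm.\<close>
  define m where "m = sqrt (2 / \<delta> * (hardy2_norm f)\<^sup>2)"
  have m: "cmod (f w) \<le> m" if "cmod w \<le> 1 - \<delta>" for w
    unfolding m_def
  proof (rule real_le_rsqrt)
    have "(1 + cmod w) / (1 - cmod w) \<le> 2 / \<delta>"
      using that \<open>0 < \<delta>\<close> by (intro frac_le) auto
    moreover have "w \<in> unit_disc" using that \<open>0 < \<delta>\<close> by simp
    ultimately show "(cmod (f w))\<^sup>2 \<le> 2 / \<delta> * (hardy2_norm f)\<^sup>2"
      by (intro order_trans[OF hardy2_point_evaluation[OF f_hol hardy2_circle_mean_square_le[OF f]] mult_right_mono]) auto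
  qed
  have "0 \<le> m" using \<open>0 < \<delta>\<close> by (simp add: m_def)
  have "circle_mean_square (weighted_comp h \<phi> f) r
      \<le> (c\<^sup>2 * norm_const + 2 / \<delta> * (hardy2_norm h)\<^sup>2) * (hardy2_norm f)\<^sup>2" if "0 \<le> r" "r < 1" for r
    using weighted_comp_mean_square_le[OF assms m \<open>0 \<le> m\<close> that] \<open>0 < \<delta>\<close>
    by (simp add: m_def algebra_simps)
  then show "weighted_comp h \<phi> f \<in> hardy2"
    and "(hardy2_norm (weighted_comp h \<phi> f))\<^sup>2 \<le> (c\<^sup>2 * norm_const + 2 / \<delta> * (hardy2_norm h)\<^sup>2) * (hardy2_norm f)\<^sup>2"
    by (auto intro: hardy2I[OF weighted_comp_holomorphic[OF f_hol]])
qed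

lemma weighted_comp_linear:
  assumes "weight_bound \<delta> c" "0 \<le> c" "0 < \<delta>"
  shows "linear_on_hardy2 (weighted_comp h \<phi>)"
  unfolding linear_on_hardy2_def
  using weighted_comp_hardy2(1)[OF assms] by (auto simp: weighted_comp_def algebra_simps)

theorem weighted_comp_bounded:
  assumes wb: "weight_bound \<delta> c" "0 \<le> c" "0 < \<delta>"
  shows "bounded_on_hardy2 (weighted_comp h \<phi>)"
  unfolding bounded_on_hardy2_def
proof (intro conjI exI ballI)
  show "linear_on_hardy2 (weighted_comp h \<phi>)" by (rule weighted_comp_linear[OF wb])
  fix f assume f: "f \<in> hardy2"
  let ?D = "c\<^sup>2 * norm_const + 2 / \<delta> * (hardy2_norm h)\<^sup>2"
  have D: "0 \<le> ?D" using norm_const_nonneg \<open>0 < \<delta>\<close> by simp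
  show "hardy2_norm (weighted_comp h \<phi> f) \<le> sqrt ?D * hardy2_norm f"
  proof (rule power2_le_imp_le)
    show "(hardy2_norm (weighted_comp h \<phi> f))\<^sup>2 \<le> (sqrt ?D * hardy2_norm f)\<^sup>2"
      using weighted_comp_hardy2(2)[OF wb f] D by (simp add: power_mult_distrib)
    show "0 \<le> sqrt ?D * hardy2_norm f" using D hardy2_norm_nonneg[OF f] by simp
  qed
qed

end

text \<open>Point evaluation makes a norm-bounded sequence locally bounded, so Montel's theorem
  applies, and Fatou's lemma bounds the mean squares of the limit. Local uniform convergence with
  bounded norms is the concrete form of weak convergence here. The constant 4 comes from the factor
  2 on each of the two mean squares of a difference.\<close>

lemma hardy2_weak_compactness:
  assumes F: "\<And>n. F n \<in> hardy2" and B: "\<And>n. hardy2_norm (F n) \<le> B"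
  obtains s g where "strict_mono (s :: nat \<Rightarrow> nat)" "g \<in> hardy2"
    "\<And>n. (\<lambda>z. F (s n) z - g z) \<in> hardy2"
    "\<And>n. (hardy2_norm (\<lambda>z. F (s n) z - g z))\<^sup>2 \<le> 4 * B\<^sup>2"
    "\<And>K. compact K \<Longrightarrow> K \<subseteq> unit_disc \<Longrightarrow> uniform_limit K (\<lambda>n. F (s n)) g sequentially"
proof -
  \<comment> \<open>Montel's theorem is stated for a family; this one is the ball of radius
    \<open>B\<close>, phrased by mean squares so that point evaluation applies directly.\<close>
  define \<H> where "\<H> = {f. f holomorphic_on unit_disc \<and> (\<forall>r. 0 \<le> r \<and> r < 1 \<longrightarrow> circle_mean_square f r \<le> B\<^sup>2)}"
  have F_hol: "F n holomorphic_on unit_disc" for n using F[of n] by (simp add: hardy2_def)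
  have F_le: "circle_mean_square (F n) r \<le> B\<^sup>2" if "0 \<le> r" "r < 1" for n r
    by (rule order_trans[OF hardy2_circle_mean_square_le[OF F that]])
       (intro power_mono B hardy2_norm_nonneg F)
  have rng: "range F \<subseteq> \<H>" unfolding \<H>_def using F_hol F_le by auto
  have bdd: "\<exists>C. \<forall>h\<in>\<H>. \<forall>z\<in>K. cmod (h z) \<le> C" if K: "compact K" "K \<subseteq> unit_disc" for K
  proof -
    have "compact ((\<lambda>w. (1 + cmod w) / (1 - cmod w)) ` K)"
      using K by (intro compact_continuous_image continuous_intros) auto
    then obtain C where C: "\<And>w. w \<in> K \<Longrightarrow> norm ((1 + cmod w) / (1 - cmod w)) \<le> C"
      by (meson compact_imp_bounded bounded_iff imageI)
    have "cmod (f w) \<le> sqrt (C * B\<^sup>2)" if "f \<in> \<H>" "w \<in> K" for f w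
    proof (rule real_le_rsqrt)
      have "(cmod (f w))\<^sup>2 \<le> (1 + cmod w) / (1 - cmod w) * B\<^sup>2"
        using that K by (intro hardy2_point_evaluation) (auto simp: \<H>_def)
      also have "\<dots> \<le> C * B\<^sup>2" 
        by (intro mult_right_mono order_trans[OF abs_ge_self C[OF \<open>w \<in> K\<close>, unfolded real_norm_def]]) auto
      finally show "(cmod (f w))\<^sup>2 \<le> C * B\<^sup>2" .
    qed
    then show ?thesis by blast
  qed
  have hol: "f holomorphic_on unit_disc" if "f \<in> \<H>" for f using that by (simp add: \<H>_def)
  obtain g s where g: "g holomorphic_on unit_disc" "strict_mono (s :: nat \<Rightarrow> nat)"
      "\<And>x. x \<in> unit_disc \<Longrightarrow> (\<lambda>n. F (s n) x) \<longlonglongrightarrow> g x"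
      "\<And>K. compact K \<Longrightarrow> K \<subseteq> unit_disc \<Longrightarrow> uniform_limit K (F \<circ> s) g sequentially"
    by (rule Montel[OF open_ball hol bdd rng]) (assumption | rule that)+
  have g_le: "circle_mean_square g r \<le> B\<^sup>2" if "0 \<le> r" "r < 1" for r
    by (rule circle_mean_square_pointwise_limit[OF F_hol g(1) g(3) that F_le[OF that] tendsto_const])
  have hol: "(\<lambda>z. F (s n) z - g z) holomorphic_on unit_disc" for n
    by (intro holomorphic_intros F_hol g(1))
  have le: "circle_mean_square (\<lambda>z. F (s n) z - g z) r \<le> 4 * B\<^sup>2" if "0 \<le> r" "r < 1" for n r
    using circle_mean_square_diff_le[OF F_hol[of "s n"] g(1) that] F_le[OF that, of "s n"] g_le[OF that] by linarith
  show ?thesis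
    by (rule that[OF g(2) hardy2I(1)[OF g(1) g_le] hardy2I(1)[OF hol le] hardy2I(2)[OF hol le]])
       (use g(4) in \<open>auto simp: o_def\<close>)
qed

section \<open>Compactness of the operator\<close>

context weighted_composition
begin

theorem weighted_comp_compact:
  assumes "0 < \<delta>\<^sub>0" and c: "\<And>\<delta>. 0 < \<delta> \<Longrightarrow> \<delta> < \<delta>\<^sub>0 \<Longrightarrow> 0 < c \<delta> \<and> weight_bound \<delta> (c \<delta>)"
    and lim: "(c \<longlongrightarrow> 0) (at_right 0)"
  shows "compact_on_hardy2 (weighted_comp h \<phi>)"
  unfolding compact_on_hardy2_def
proof (intro conjI allI impI)
  \<comment> \<open>A single admissible \<delta> ensures that the operator maps the space into
    itself; the small values serve only the convergence.\<close>
  have half: "weight_bound (\<delta>\<^sub>0 / 2) (c (\<delta>\<^sub>0 / 2))" "0 \<le> c (\<delta>\<^sub>0 / 2)" "0 < \<delta>\<^sub>0 / 2"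
    using c[of "\<delta>\<^sub>0 / 2"] \<open>0 < \<delta>\<^sub>0\<close> by auto
  show "linear_on_hardy2 (weighted_comp h \<phi>)" by (rule weighted_comp_linear[OF half])
  fix F :: "nat \<Rightarrow> complex \<Rightarrow> complex"
  assume "(\<forall>n. F n \<in> hardy2) \<and> (\<exists>B. \<forall>n. hardy2_norm (F n) \<le> B)"
  then obtain B where F: "\<And>n. F n \<in> hardy2" "\<And>n. hardy2_norm (F n) \<le> B" by auto
  obtain s g where sg: "strict_mono (s :: nat \<Rightarrow> nat)" "g \<in> hardy2"
    "\<And>n. (\<lambda>z. F (s n) z - g z) \<in> hardy2"
    "\<And>n. (hardy2_norm (\<lambda>z. F (s n) z - g z))\<^sup>2 \<le> 4 * B\<^sup>2"
    "\<And>K. compact K \<Longrightarrow> K \<subseteq> unit_disc \<Longrightarrow> uniform_limit K (\<lambda>n. F (s n)) g sequentially"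
    by (rule hardy2_weak_compactness[OF F]) (assumption | rule that)+
  define G where "G n z = F (s n) z - g z" for n z
  have G: "G n \<in> hardy2" "(hardy2_norm (G n))\<^sup>2 \<le> 4 * B\<^sup>2" for n
    using sg(3,4)[of n] by (simp_all add: G_def[abs_def])
  have G_hol: "G n holomorphic_on unit_disc" for n using G(1)[of n] by (simp add: hardy2_def)
  have WG: "weighted_comp h \<phi> (G n) \<in> hardy2" for n by (rule weighted_comp_hardy2(1)[OF half G(1)])
  have "(\<lambda>n. (hardy2_norm (weighted_comp h \<phi> (G n)))\<^sup>2) \<longlonglongrightarrow> 0"
  proof (rule tendstoI)
    fix e :: real assume "0 < e"
    have "((\<lambda>\<delta>. (c \<delta>)\<^sup>2 * (norm_const * (4 * B\<^sup>2))) \<longlongrightarrow> 0\<^sup>2 * (norm_const * (4 * B\<^sup>2))) (at_right 0)"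
      by (intro tendsto_intros lim)
    then have "\<forall>\<^sub>F \<delta> in at_right 0. (c \<delta>)\<^sup>2 * (norm_const * (4 * B\<^sup>2)) < e / 2"
      using \<open>0 < e\<close> by (intro order_tendstoD) auto
    moreover have "\<forall>\<^sub>F \<delta> in at_right 0. \<delta> \<in> {0<..<\<delta>\<^sub>0}"
      using \<open>0 < \<delta>\<^sub>0\<close> by (rule eventually_at_right_real)
    ultimately have "\<forall>\<^sub>F \<delta> in at_right 0. (c \<delta>)\<^sup>2 * (norm_const * (4 * B\<^sup>2)) < e / 2 \<and> \<delta> \<in> {0<..<\<delta>\<^sub>0}"
      by (rule eventually_conj)
    then obtain \<delta> where \<delta>: "(c \<delta>)\<^sup>2 * (norm_const * (4 * B\<^sup>2)) < e / 2" "0 < \<delta>" "\<delta> < \<delta>\<^sub>0"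
      using eventually_happens[of _ "at_right (0 :: real)"] by (auto simp: trivial_limit_at_right_real)
    have wb: "weight_bound \<delta> (c \<delta>)" "0 \<le> c \<delta>" using c[OF \<delta>(2,3)] by auto
    \<comment> \<open>Chosen so that the term with the norm of h is at most e/2; the summand 1
      avoids division by zero when h vanishes on the disc.\<close>
    define \<eta> where "\<eta> = sqrt (e / 2 / ((hardy2_norm h)\<^sup>2 + 1))"
    have den: "0 < (hardy2_norm h)\<^sup>2 + 1" by (simp add: add_nonneg_pos)
    have \<eta>: "0 < \<eta>" unfolding \<eta>_def using \<open>0 < e\<close> den by simp
    have \<eta>2: "\<eta>\<^sup>2 * (hardy2_norm h)\<^sup>2 \<le> e / 2"
    proof -
      have "\<eta>\<^sup>2 = e / 2 / ((hardy2_norm h)\<^sup>2 + 1)" unfolding \<eta>_def using \<open>0 < e\<close> den by simp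
      moreover have "x / d * d = x" if "0 < d" for x d :: real using that by simp
      ultimately have "\<eta>\<^sup>2 * ((hardy2_norm h)\<^sup>2 + 1) = e / 2" using den by (simp only:)
      moreover have "\<eta>\<^sup>2 * (hardy2_norm h)\<^sup>2 \<le> \<eta>\<^sup>2 * ((hardy2_norm h)\<^sup>2 + 1)" by (intro mult_left_mono) auto
      ultimately show ?thesis by (simp only:)
    qed
    have "uniform_limit (cball 0 (1 - \<delta>)) (\<lambda>n. F (s n)) g sequentially"
      using \<delta>(2) by (intro sg(5)) auto
    from uniform_limitD[OF this \<eta>]
    show "\<forall>\<^sub>F n in sequentially. dist ((hardy2_norm (weighted_comp h \<phi> (G n)))\<^sup>2) 0 < e"
    proof eventually_elim
      case (elim n)
      then have m: "cmod (G n w) \<le> \<eta>" if "cmod w \<le> 1 - \<delta>" for w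
        using that by (force simp: G_def dist_norm)
      have "(hardy2_norm (weighted_comp h \<phi> (G n)))\<^sup>2
          \<le> (c \<delta>)\<^sup>2 * (norm_const * (hardy2_norm (G n))\<^sup>2) + \<eta>\<^sup>2 * (hardy2_norm h)\<^sup>2"
        by (rule hardy2I(2)[OF weighted_comp_holomorphic[OF G_hol]
              weighted_comp_mean_square_le[OF wb \<delta>(2) G(1) m less_imp_le[OF \<eta>]]])
      also have "\<dots> \<le> (c \<delta>)\<^sup>2 * (norm_const * (4 * B\<^sup>2)) + e / 2"
        by (intro add_mono mult_left_mono G \<eta>2 norm_const_nonneg) auto
      also have "\<dots> < e" using \<delta>(1) by simp
      finally show ?case by simp
    qed
  qed
  then have "(\<lambda>n. sqrt ((hardy2_norm (weighted_comp h \<phi> (G n)))\<^sup>2)) \<longlonglongrightarrow> sqrt 0"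
    by (intro tendsto_intros)
  then have "(\<lambda>n. hardy2_norm (weighted_comp h \<phi> (G n))) \<longlonglongrightarrow> 0"
    by (simp add: hardy2_norm_nonneg[OF WG])
  \<comment> \<open>By linearity the witness for the norm limit is the image of the weak limit
    \<open>g\<close>.\<close>
  moreover have "weighted_comp h \<phi> (G n) = (\<lambda>z. weighted_comp h \<phi> (F (s n)) z - weighted_comp h \<phi> g z)" for n
    by (simp add: weighted_comp_def G_def fun_eq_iff algebra_simps)
  ultimately show "\<exists>s g. strict_mono s \<and> g \<in> hardy2 \<and>
      (\<lambda>n. hardy2_norm (\<lambda>z. weighted_comp h \<phi> (F (s n)) z - g z)) \<longlonglongrightarrow> 0"
    using sg(1) weighted_comp_hardy2(1)[OF half sg(2)] by auto
qed

end

theorem theorem2p9: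
  fixes \<phi> h :: "complex \<Rightarrow> complex"
  assumes "\<phi> holomorphic_on unit_disc"
    and "\<phi> ` unit_disc \<subseteq> unit_disc"
    and "h \<in> hardy2"
  shows "((\<exists>\<delta>>0. \<exists>c>0. AE z in circle_measure.
              z \<in> near_boundary_set \<phi> \<delta> \<longrightarrow> cmod (radial_limit h z) \<le> c)
            \<longrightarrow> bounded_on_hardy2 (weighted_comp h \<phi>))
       \<and> ((\<exists>c :: real \<Rightarrow> real.
              (\<exists>\<delta>\<^sub>0>0. \<forall>\<delta>. 0 < \<delta> \<and> \<delta> < \<delta>\<^sub>0 \<longrightarrow> c \<delta> > 0 \<and>
                 (AE z in circle_measure.
                    z \<in> near_boundary_set \<phi> \<delta> \<longrightarrow> cmod (radial_limit h z) \<le> c \<delta>)) \<and>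
              (c \<longlongrightarrow> 0) (at_right 0))
            \<longrightarrow> compact_on_hardy2 (weighted_comp h \<phi>))"
proof -
  interpret weighted_composition \<phi> h using assms by unfold_locales
  show ?thesis
  proof (intro conjI impI)
    assume "\<exists>\<delta>>0. \<exists>c>0. AE z in circle_measure.
              z \<in> near_boundary_set \<phi> \<delta> \<longrightarrow> cmod (radial_limit h z) \<le> c"
    then obtain \<delta> c where "0 < \<delta>" "0 < c" "weight_bound \<delta> c"
      unfolding weight_bound_def by blast
    then show "bounded_on_hardy2 (weighted_comp h \<phi>)"
      by (intro weighted_comp_bounded) auto
  next
    assume "\<exists>c :: real \<Rightarrow> real.
              (\<exists>\<delta>\<^sub>0>0. \<forall>\<delta>. 0 < \<delta> \<and> \<delta> < \<delta>\<^sub>0 \<longrightarrow> c \<delta> > 0 \<and>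
                 (AE z in circle_measure.
                    z \<in> near_boundary_set \<phi> \<delta> \<longrightarrow> cmod (radial_limit h z) \<le> c \<delta>)) \<and>
              (c \<longlongrightarrow> 0) (at_right 0)"
    then obtain c \<delta>\<^sub>0 where "0 < \<delta>\<^sub>0" "(c \<longlongrightarrow> 0) (at_right 0)"
        "\<And>\<delta>. 0 < \<delta> \<Longrightarrow> \<delta> < \<delta>\<^sub>0 \<Longrightarrow> 0 < c \<delta> \<and> weight_bound \<delta> (c \<delta>)"
      unfolding weight_bound_def by blast
    then show "compact_on_hardy2 (weighted_comp h \<phi>)"
      by (intro weighted_comp_compact) auto
  qed
qed

end
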